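(* Let $p$ be an arbitrary prime and $n\ge 1$. Then $P_n$ has a characteristic abelian subgroup $B$ with the following properties: (1) $P_n/B\cong P_{n-1}$; (2) the action of $P_{n-1}\cong P_n/B$ on $B$ (induced by conjugation) is uniserial.
   Context: For $m\ge 0$, $P_m$ denotes a Sylow $p$-subgroup of the symmetric group $S_{p^m}$; it is the $m$-fold iterated wreath product $C_p\wr C_p\wr\cdots\wr C_p$ (with $P_0=1$). Let $P$ and $M$ be finite $p$-groups, with $M$ abelian and $P$ acting on $M$ by automorphisms. The action is called uniserial if $[P,N]$ has index $p$ in $N$ for every $P$-invariant subgroup $1\ne N\le M$, where $[P,N]$ is the subgroup generated by all elements $({}^g x)x^{-1}$ with $g\in P$, $x\in N$. *)

theory Defs
  imports "HOL-Algebra.Algebra" "HOL-Computational_Algebra.Primes"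
begin

hide_const (open) Divisibility.prime

definition finite_p_group :: "nat \<Rightarrow> ('a, 'b) monoid_scheme \<Rightarrow> bool" where
  "finite_p_group p G \<longleftrightarrow>
     prime p \<and> group G \<and> finite (carrier G) \<and> (\<exists>k. order G = p ^ k)"

definition sylow_subgroup :: "nat \<Rightarrow> 'a set \<Rightarrow> ('a, 'b) monoid_scheme \<Rightarrow> bool" where
  "sylow_subgroup p H G \<longleftrightarrow>
     finite (carrier G) \<and> subgroup H G \<and> card H = p ^ multiplicity p (order G)"

text \<open>\<open>is_P p m G\<close>: the group \<open>G\<close> is a \<open>P\<^sub>m\<close>, i.e. some Sylow \<open>p\<close>-subgroup of the symmetric group
  on \<open>{1..p ^ m}\<close>, regarded as a group of its own. It is determined only up to conjugacy,
  hence a predicate and not a function of \<open>m\<close>.\<close>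

definition is_P :: "nat \<Rightarrow> nat \<Rightarrow> (nat \<Rightarrow> nat) monoid \<Rightarrow> bool" where
  "is_P p m G \<longleftrightarrow>
     (\<exists>S. sylow_subgroup p S (sym_group (p ^ m)) \<and> G = (sym_group (p ^ m))\<lparr>carrier := S\<rparr>)"

definition characteristic_subgroup :: "'a set \<Rightarrow> ('a, 'b) monoid_scheme \<Rightarrow> bool" where
  "characteristic_subgroup B G \<longleftrightarrow> subgroup B G \<and> (\<forall>\<alpha>\<in>auto G. \<alpha> ` B = B)"

definition invariant_subgroup ::
  "('a, 'b) monoid_scheme \<Rightarrow> ('c, 'd) monoid_scheme \<Rightarrow> ('a \<Rightarrow> 'c \<Rightarrow> 'c) \<Rightarrow> 'c set \<Rightarrow> bool" where
  "invariant_subgroup P M \<phi> N \<longleftrightarrow>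
     subgroup N M \<and> (\<forall>g\<in>carrier P. \<forall>x\<in>N. \<phi> g x \<in> N)"

definition action_commutator ::
  "('a, 'b) monoid_scheme \<Rightarrow> ('c, 'd) monoid_scheme \<Rightarrow> ('a \<Rightarrow> 'c \<Rightarrow> 'c) \<Rightarrow> 'c set \<Rightarrow> 'c set" where
  "action_commutator P M \<phi> N =
     generate M {\<phi> g x \<otimes>\<^bsub>M\<^esub> inv\<^bsub>M\<^esub> x | g x. g \<in> carrier P \<and> x \<in> N}"

text \<open>The last conjunct counts the cosets of \<open>[P, N]\<close> in \<open>N\<close>.\<close>

definition uniserial_action ::
  "nat \<Rightarrow> ('a, 'b) monoid_scheme \<Rightarrow> ('c, 'd) monoid_scheme \<Rightarrow> ('a \<Rightarrow> 'c \<Rightarrow> 'c) \<Rightarrow> bool" where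
  "uniserial_action p P M \<phi> \<longleftrightarrow>
     finite_p_group p P \<and> finite_p_group p M \<and> comm_group M \<and>
     \<phi> \<in> hom P (AutoGroup M) \<and>
     (\<forall>N. invariant_subgroup P M \<phi> N \<and> N \<noteq> {\<one>\<^bsub>M\<^esub>} \<longrightarrow>
        card (rcosets\<^bsub>M\<lparr>carrier := N\<rparr>\<^esub> (action_commutator P M \<phi> N)) = p)"

text \<open>For an abelian normal subgroup \<open>B\<close> of \<open>G\<close>, conjugation induces an action of \<open>G Mod B\<close>
  on \<open>B\<close>: a coset acts by conjugation with any of its elements. Independence of the
  representative is the lemma \<open>coset_conj_eq\<close>. The \<open>restrict\<close> is needed because members of
  \<^const>\<open>AutoGroup\<close> are extensional functions.\<close>

definition coset_conj :: "('a, 'b) monoid_scheme \<Rightarrow> 'a set \<Rightarrow> 'a set \<Rightarrow> 'a \<Rightarrow> 'a" where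
  "coset_conj G B C =
     (\<lambda>x\<in>B. (SOME g. g \<in> C) \<otimes>\<^bsub>G\<^esub> x \<otimes>\<^bsub>G\<^esub> inv\<^bsub>G\<^esub> (SOME g. g \<in> C))"

lemma coset_conj_eq:
  assumes "normal B G" and "comm_group (G\<lparr>carrier := B\<rparr>)"
    and C: "C \<in> carrier (G Mod B)" and g: "g \<in> C" and x: "x \<in> B"
  shows "coset_conj G B C x = g \<otimes>\<^bsub>G\<^esub> x \<otimes>\<^bsub>G\<^esub> inv\<^bsub>G\<^esub> g"
proof -
  interpret normal B G by fact
  define h where "h = (SOME g. g \<in> C)"
  have h: "h \<in> C" unfolding h_def using g by (rule someI)
  obtain a where a: "a \<in> carrier G" "C = B #>\<^bsub>G\<^esub> a"
    using C by (auto simp: FactGroup_def RCOSETS_def)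
  have "a <#\<^bsub>G\<^esub> B = C" using a coset_eq by auto
  then obtain b c where b: "b \<in> B" "h = a \<otimes>\<^bsub>G\<^esub> b" and c: "c \<in> B" "g = a \<otimes>\<^bsub>G\<^esub> c"
    using g h by (auto simp: l_coset_def)
  have comm: "u \<otimes>\<^bsub>G\<^esub> v = v \<otimes>\<^bsub>G\<^esub> u" if "u \<in> B" "v \<in> B" for u v
    using comm_groupE(4)[OF assms(2)] that by simp
  have conj: "(a \<otimes>\<^bsub>G\<^esub> d) \<otimes>\<^bsub>G\<^esub> x \<otimes>\<^bsub>G\<^esub> inv\<^bsub>G\<^esub> (a \<otimes>\<^bsub>G\<^esub> d) = a \<otimes>\<^bsub>G\<^esub> x \<otimes>\<^bsub>G\<^esub> inv\<^bsub>G\<^esub> a"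
    if d: "d \<in> B" for d
  proof -
    have cl: "d \<in> carrier G" "x \<in> carrier G" "inv\<^bsub>G\<^esub> d \<in> carrier G" using d x by auto
    have "(a \<otimes>\<^bsub>G\<^esub> d) \<otimes>\<^bsub>G\<^esub> x \<otimes>\<^bsub>G\<^esub> inv\<^bsub>G\<^esub> (a \<otimes>\<^bsub>G\<^esub> d)
        = a \<otimes>\<^bsub>G\<^esub> (d \<otimes>\<^bsub>G\<^esub> x) \<otimes>\<^bsub>G\<^esub> inv\<^bsub>G\<^esub> d \<otimes>\<^bsub>G\<^esub> inv\<^bsub>G\<^esub> a"
      using a cl by (simp add: inv_mult_group m_assoc)
    also have "\<dots> = a \<otimes>\<^bsub>G\<^esub> (x \<otimes>\<^bsub>G\<^esub> d) \<otimes>\<^bsub>G\<^esub> inv\<^bsub>G\<^esub> d \<otimes>\<^bsub>G\<^esub> inv\<^bsub>G\<^esub> a"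
      using comm[OF d x] by simp
    also have "\<dots> = a \<otimes>\<^bsub>G\<^esub> x \<otimes>\<^bsub>G\<^esub> (d \<otimes>\<^bsub>G\<^esub> inv\<^bsub>G\<^esub> d) \<otimes>\<^bsub>G\<^esub> inv\<^bsub>G\<^esub> a"
      using a cl by (simp only: m_assoc m_closed inv_closed)
    finally show ?thesis using a cl by simp
  qed
  show ?thesis
    unfolding coset_conj_def h_def[symmetric] using x b c conj by simp
qed

end

theory Submission
  imports Defs
begin

text \<open>Let \<open>D\<close> be the group of affine maps \<open>i \<mapsto> e * i + b\<close> of \<open>\<int> / q\<close>, where \<open>e\<close> ranges over a group \<open>E\<close>
  of units: \<open>q = p\<close> and \<open>E = {1}\<close> in general, but \<open>q = 4\<close> and \<open>E = {1, 3}\<close> (so \<open>D\<close> is dihedral of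
  order 8) if \<open>p = 2\<close> and \<open>n \<ge> 2\<close>, because the base group of \<open>C\<^sub>2 \<wr> P\<^bsub>n-1\<^esub>\<close> is then not characteristic.
  For a Sylow subgroup \<open>V\<close> of the symmetric group on \<open>N\<close> blocks, where \<open>N * q = p ^ n\<close>, the wreath
  product \<open>W = D \<wr> V\<close> acts on \<open>p ^ n\<close> points and has the order of a Sylow subgroup, so
  \<open>W \<cong> P\<^sub>n\<close> by Sylow's conjugacy theorem. Let \<open>B\<close> be the group of translations in all blocks.
  Then \<open>W / B \<cong> E \<wr> V\<close> acts faithfully on \<open>N * card E = p ^ (n - 1)\<close> points and again has the
  order of a Sylow subgroup, so it is \<open>P\<^bsub>n-1\<^esub>\<close>.

  The image \<open>A\<close> of \<open>B\<close> under an automorphism is abelian and normal, so \<open>[B, A, A] = 1\<close>, and this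
  forces \<open>A\<close> to fix all blocks. If \<open>q = 4\<close>, the squares of elements of \<open>A\<close> and of \<open>B\<close> coincide, so \<open>A\<close>
  contains an element that is a rotation of order 4 in every block; only translations
  commute with it. Hence \<open>A = B\<close>.

  An action of a \<open>p\<close>-group on an abelian \<open>p\<close>-group is uniserial as soon as some element \<open>g\<close> has
  at most \<open>p\<close> fixed points: \<open>[P, N] \<noteq> N\<close> always, while \<open>[g, N]\<close> has index at most \<open>p\<close> in \<open>N\<close>.
  Such a \<open>g\<close> is provided by a full cycle on the blocks.\<close>

section \<open>Sylow subgroups\<close>

text \<open>\<open>BijGroup U\<close> consists of extensional functions, hence the
  \<open>\<lambda>x\<in>U\<close>. Bijectivity comes from closedness: acting with
  \<open>inv g\<close> undoes acting with \<open>g\<close>.\<close>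

lemma group_actionI:
  fixes G (structure)
  assumes "group G"
    and closed: "\<And>g x. g \<in> carrier G \<Longrightarrow> x \<in> U \<Longrightarrow> act g x \<in> U"
    and one: "\<And>x. x \<in> U \<Longrightarrow> act \<one> x = x"
    and mult: "\<And>g h x. g \<in> carrier G \<Longrightarrow> h \<in> carrier G \<Longrightarrow> x \<in> U \<Longrightarrow>
      act (g \<otimes> h) x = act g (act h x)"
  shows "group_action G U (\<lambda>g. \<lambda>x\<in>U. act g x)"
proof -
  interpret group G by fact
  have bij: "bij_betw (\<lambda>x\<in>U. act g x) U U" if g: "g \<in> carrier G" for g
    by (rule bij_betw_byWitness[where f' = "act (inv g)"])
      (use g closed in \<open>auto simp: mult[symmetric] one\<close>)
  have Bij: "(\<lambda>x\<in>U. act g x) \<in> Bij U" if "g \<in> carrier G" for g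
    using bij[OF that] by (simp add: Bij_def)
  show ?thesis
    unfolding group_action_def group_hom_def group_hom_axioms_def hom_def
    using assms(1) Bij group_BijGroup[of U]
    by (auto simp: BijGroup_def compose_def mult closed fun_eq_iff)
qed

text \<open>The points that are not fixed fall into orbits whose sizes are powers of
  \<open>p\<close> other than 1, so their number is divisible by \<open>p\<close>.\<close>

lemma (in group_action) p_group_fixed_points_dvd:
  assumes "prime p" and ord: "order G = p ^ k" and fin: "finite E"
  shows "p dvd card {x\<in>E. \<forall>g\<in>carrier G. \<phi> g x = x} \<longleftrightarrow> p dvd card E"
proof -
  interpret group_hom G "BijGroup E" \<phi> by (rule group_hom)
  define F where "F = {x\<in>E. \<forall>g\<in>carrier G. \<phi> g x = x}"
  define C where "C = orbit G \<phi> ` (E - F)"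
  have sub: "orbit G \<phi> x \<subseteq> E" if "x \<in> E" for x
    using that element_image by (auto simp: orbit_def)
  have notF: "orbit G \<phi> x \<inter> F = {}" if "x \<in> E - F" for x
  proof (rule ccontr)
    assume "orbit G \<phi> x \<inter> F \<noteq> {}"
    then obtain y where y: "y \<in> orbit G \<phi> x" "y \<in> F" by blast
    then have "x \<in> orbit G \<phi> y" using that orbit_sym[of x y] by (auto simp: F_def)
    then have "x = y" using y by (auto simp: orbit_def F_def)
    then show False using that y by simp
  qed
  have un: "\<Union>C = E - F"
    using sub notF orbit_refl by (fastforce simp: C_def)
  have "p dvd card (\<Union>C)"
  proof (rule dvd_partition)
    show "finite (\<Union>C)" using un fin by simp
    show "\<forall>c\<in>C. p dvd card c"
    proof
      fix c assume "c \<in> C"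
      then obtain x where x: "x \<in> E - F" "c = orbit G \<phi> x" by (auto simp: C_def)
      have "card c dvd p ^ k"
        using orbit_stabilizer_theorem[of x] x ord by (metis DiffD1 dvd_triv_left)
      then obtain i where i: "card c = p ^ i"
        using \<open>prime p\<close> divides_primepow_nat by blast
      have "card c \<noteq> 1"
      proof
        assume "card c = 1"
        then obtain z where "c = {z}" by (auto simp: card_1_singleton_iff)
        then have "c = {x}" using orbit_refl[of x] x by auto
        then have "x \<in> F" using x by (auto simp: F_def orbit_def)
        then show False using x by simp
      qed
      then show "p dvd card c" using i by (cases i) auto
    qed
    show "\<forall>c1\<in>C. \<forall>c2\<in>C. c1 \<noteq> c2 \<longrightarrow> c1 \<inter> c2 = {}"
    proof (intro ballI impI)
      fix c1 c2 assume "c1 \<in> C" "c2 \<in> C" "c1 \<noteq> c2"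
      then show "c1 \<inter> c2 = {}"
        using disjoint_union[of c1 c2] by (auto simp: C_def orbits_def)
    qed
  qed
  moreover have "card E = card F + card (E - F)"
    using fin by (metis (no_types, lifting) F_def card_Diff_subset card_mono finite_subset
        le_add_diff_inverse mem_Collect_eq subsetI)
  ultimately show ?thesis
    using un by (simp add: F_def dvd_add_left_iff)
qed

text \<open>A \<open>p\<close>-subgroup \<open>Q\<close> acts on the cosets of the Sylow subgroup \<open>S\<close>; their number is prime
  to \<open>p\<close>, so there is a fixed coset \<open>S x\<close>, which means that \<open>x\<close> conjugates \<open>Q\<close> into \<open>S\<close>.\<close>

lemma p_subgroup_conj_into_sylow:
  fixes G (structure)
  assumes "group G" and "prime p" and S: "sylow_subgroup p S G"
    and Q: "subgroup Q G" and cQ: "card Q = p ^ k"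
  shows "\<exists>x\<in>carrier G. \<forall>q\<in>Q. x \<otimes> q \<otimes> inv x \<in> S"
proof -
  interpret group G by fact
  have fin: "finite (carrier G)" and sub: "subgroup S G"
    and cS: "card S = p ^ multiplicity p (order G)"
    using S by (auto simp: sylow_subgroup_def)
  interpret Q: subgroup Q G by fact
  interpret S: subgroup S G by fact
  let ?Q = "G\<lparr>carrier := Q\<rparr>"
  \<comment> \<open>Cosets \<open>S x\<close> are multiplied on the right; the inverse turns this
    into a left action.\<close>
  let ?act = "\<lambda>q U. U #> inv q"
  have cos: "U \<subseteq> carrier G" if "U \<in> rcosets S" for U
    using rcosets_part_G[OF sub] that by blast
  interpret act: group_action ?Q "rcosets S" "\<lambda>q. \<lambda>U\<in>rcosets S. ?act q U"
  proof (rule group_actionI)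
    show "group ?Q" by (rule subgroup_imp_group[OF Q])
  next
    fix q U assume "q \<in> carrier ?Q" "U \<in> rcosets S"
    then show "U #> inv q \<in> rcosets S"
      by (auto simp: RCOSETS_def coset_mult_assoc[OF S.subset])
  next
    fix U assume "U \<in> rcosets S"
    then show "U #> inv \<one>\<^bsub>?Q\<^esub> = U"
      using coset_mult_one[OF cos] by simp
  next
    fix g h U assume "g \<in> carrier ?Q" "h \<in> carrier ?Q" "U \<in> rcosets S"
    then show "U #> inv (g \<otimes>\<^bsub>?Q\<^esub> h) = (U #> inv h) #> inv g"
      using cos by (simp add: coset_mult_assoc inv_mult_group)
  qed
  have lag: "card (rcosets S) * p ^ multiplicity p (order G) = order G"
    using lagrange[OF sub] cS by simp
  have pos: "order G \<noteq> 0" using fin order_gt_0_iff_finite by auto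
  have "\<not> p dvd card (rcosets S)"
  proof
    assume "p dvd card (rcosets S)"
    then have "p ^ Suc (multiplicity p (order G)) dvd order G"
      using lag by (metis mult_dvd_mono dvd_refl power_Suc)
    then show False
      using pos \<open>prime p\<close> by (metis multiplicity_geI not_less_eq_eq not_prime_unit order_refl)
  qed
  moreover have "finite (rcosets S)"
    using fin rcosets_part_G[OF sub] by (metis finite_UnionD)
  ultimately have "\<not> p dvd card {U \<in> rcosets S. \<forall>q\<in>carrier ?Q. (\<lambda>U\<in>rcosets S. ?act q U) U = U}"
    using act.p_group_fixed_points_dvd[OF \<open>prime p\<close>, of k] cQ by (simp add: order_def)
  then have "{U \<in> rcosets S. \<forall>q\<in>carrier ?Q. (\<lambda>U\<in>rcosets S. ?act q U) U = U} \<noteq> {}"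
    by (metis card.empty dvd_0_right)
  then obtain U where U: "U \<in> rcosets S" "\<And>q. q \<in> Q \<Longrightarrow> U #> inv q = U" by auto
  then obtain x where x: "x \<in> carrier G" "U = S #> x" by (auto simp: RCOSETS_def)
  have "x \<otimes> q \<otimes> inv x \<in> S" if q: "q \<in> Q" for q
  proof -
    have "x \<in> U" using x rcos_self[OF x(1) sub] by simp
    then have "x \<otimes> q \<in> U #> q" unfolding r_coset_def by blast
    also have "U #> q = U" using U(2)[of "inv q"] q by simp
    finally obtain s where s: "s \<in> S" "x \<otimes> q = s \<otimes> x" using x by (auto simp: r_coset_def)
    then have "x \<otimes> q \<otimes> inv x = s" using x(1) by (simp add: m_assoc)
    then show ?thesis using s by simp
  qed
  then show ?thesis using x(1) by blast
qed

text \<open>Some conjugation maps \<open>T\<close> into \<open>S\<close>; it is injective and the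
  orders agree, so it is onto.\<close>

lemma sylow_subgroups_iso:
  fixes G (structure)
  assumes "group G" and "prime p" and S: "sylow_subgroup p S G" and T: "sylow_subgroup p T G"
  shows "G\<lparr>carrier := T\<rparr> \<cong> G\<lparr>carrier := S\<rparr>"
proof -
  interpret group G by fact
  have T': "subgroup T G" "card T = p ^ multiplicity p (order G)"
    and S': "subgroup S G" "card S = p ^ multiplicity p (order G)" "finite (carrier G)"
    using S T by (auto simp: sylow_subgroup_def)
  interpret T: subgroup T G by fact
  obtain x where x: "x \<in> carrier G" "\<And>q. q \<in> T \<Longrightarrow> x \<otimes> q \<otimes> inv x \<in> S"
    using p_subgroup_conj_into_sylow[OF assms(1-3) T'] by blast
  let ?f = "\<lambda>q. x \<otimes> q \<otimes> inv x"
  have inj: "inj_on ?f T"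
    using x(1) conjugation_is_inj by (auto intro!: inj_onI)
  have "?f ` T = S"
  proof (rule card_subset_eq)
    show "finite S" using S' by (meson finite_subset subgroup.subset)
    show "?f ` T \<subseteq> S" using x by blast
    show "card (?f ` T) = card S" using card_image[OF inj] S' T' by simp
  qed
  moreover have "?f \<in> hom (G\<lparr>carrier := T\<rparr>) (G\<lparr>carrier := S\<rparr>)"
  proof (rule homI)
    fix a b assume "a \<in> carrier (G\<lparr>carrier := T\<rparr>)" "b \<in> carrier (G\<lparr>carrier := T\<rparr>)"
    then have "a \<in> carrier G" "b \<in> carrier G" by auto
    moreover have "?f a \<otimes> ?f b = x \<otimes> a \<otimes> (inv x \<otimes> x) \<otimes> b \<otimes> inv x"
      using x(1) calculation by (simp only: m_assoc m_closed inv_closed)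
    ultimately show "?f (a \<otimes>\<^bsub>G\<lparr>carrier := T\<rparr>\<^esub> b) = ?f a \<otimes>\<^bsub>G\<lparr>carrier := S\<rparr>\<^esub> ?f b"
      using x(1) by (simp add: m_assoc)
  qed (use x in auto)
  ultimately have "?f \<in> iso (G\<lparr>carrier := T\<rparr>) (G\<lparr>carrier := S\<rparr>)"
    using inj by (simp add: iso_iff)
  then show ?thesis by (auto simp: is_iso_def)
qed

text \<open>With its image as codomain \<open>h\<close> becomes surjective, so the first isomorphism
  theorem applies.\<close>

lemma (in group_hom) FactGroup_image_iso:
  "G Mod kernel G H h \<cong> H\<lparr>carrier := h ` carrier G\<rparr>"
proof -
  have "group_hom G (H\<lparr>carrier := h ` carrier G\<rparr>) h"
    using H.subgroup_imp_group[OF img_is_subgroup] G.is_group homh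
    by (auto simp: group_hom_def group_hom_axioms_def hom_def)
  from group_hom.FactGroup_iso[OF this] show ?thesis by (simp add: kernel_def)
qed

lemma (in group_hom) card_image_mult_card_kernel:
  "card (h ` carrier G) * card (kernel G H h) = order G"
  using iso_same_card[OF FactGroup_image_iso] G.lagrange[OF subgroup_kernel]
  by (simp add: FactGroup_def)

section \<open>Uniserial actions\<close>

text \<open>These are the conjuncts of \<open>uniserial_action\<close> other than the index
  condition, which is derived inside the locale from a bound on fixed points.\<close>

locale p_module =
  fixes p :: nat and P :: "('a, 'b) monoid_scheme" and M :: "('c, 'd) monoid_scheme"
    and \<phi> :: "'a \<Rightarrow> 'c \<Rightarrow> 'c"
  assumes P_p_group: "finite_p_group p P" and M_p_group: "finite_p_group p M"
    and M_comm: "comm_group M" and \<phi>_hom: "\<phi> \<in> hom P (AutoGroup M)"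

sublocale p_module \<subseteq> P: group P
  using P_p_group by (simp add: finite_p_group_def)

sublocale p_module \<subseteq> M: comm_group M
  by (rule M_comm)

context p_module
begin

lemma prime_p: "prime p"
  using P_p_group by (simp add: finite_p_group_def)

lemma act_auto: "g \<in> carrier P \<Longrightarrow> \<phi> g \<in> auto M"
  using \<phi>_hom by (auto simp: hom_def AutoGroup_def)

lemma act_closed [simp]: "g \<in> carrier P \<Longrightarrow> x \<in> carrier M \<Longrightarrow> \<phi> g x \<in> carrier M"
  using act_auto[of g] by (auto simp: auto_def hom_def)

lemma act_inj: "g \<in> carrier P \<Longrightarrow> inj_on (\<phi> g) (carrier M)"
  using act_auto[of g] by (auto simp: auto_def Bij_def bij_betw_def)

lemma act_mult:
  "g \<in> carrier P \<Longrightarrow> x \<in> carrier M \<Longrightarrow> y \<in> carrier M \<Longrightarrow>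
    \<phi> g (x \<otimes>\<^bsub>M\<^esub> y) = \<phi> g x \<otimes>\<^bsub>M\<^esub> \<phi> g y"
  using act_auto[of g] by (auto simp: auto_def hom_def)

lemma act_inv:
  assumes "g \<in> carrier P" "x \<in> carrier M"
  shows "\<phi> g (inv\<^bsub>M\<^esub> x) = inv\<^bsub>M\<^esub> \<phi> g x"
proof -
  interpret group_hom M M "\<phi> g"
    using act_auto[OF assms(1)] by unfold_locales (auto simp: auto_def)
  show ?thesis using assms by simp
qed

lemma act_unit [simp]:
  assumes "g \<in> carrier P"
  shows "\<phi> g \<one>\<^bsub>M\<^esub> = \<one>\<^bsub>M\<^esub>"
proof -
  interpret group_hom M M "\<phi> g"
    using act_auto[OF assms] by unfold_locales (auto simp: auto_def)
  show ?thesis by simp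
qed

lemma act_compose:
  assumes "g \<in> carrier P" "h \<in> carrier P" "x \<in> carrier M"
  shows "\<phi> (g \<otimes>\<^bsub>P\<^esub> h) x = \<phi> g (\<phi> h x)"
proof -
  have "\<phi> (g \<otimes>\<^bsub>P\<^esub> h) = \<phi> g \<otimes>\<^bsub>AutoGroup M\<^esub> \<phi> h"
    using \<phi>_hom assms by (auto simp: hom_def)
  then show ?thesis
    using act_auto[OF assms(1)] act_auto[OF assms(2)] assms(3)
    by (simp add: AutoGroup_def BijGroup_def auto_def compose_def)
qed

lemma act_one:
  assumes "x \<in> carrier M"
  shows "\<phi> \<one>\<^bsub>P\<^esub> x = x"
proof -
  have "\<phi> \<one>\<^bsub>P\<^esub> (\<phi> \<one>\<^bsub>P\<^esub> x) = \<phi> \<one>\<^bsub>P\<^esub> x"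
    using act_compose[of "\<one>\<^bsub>P\<^esub>" "\<one>\<^bsub>P\<^esub>" x] assms by simp
  then show ?thesis
    using act_inj[of "\<one>\<^bsub>P\<^esub>"] assms by (auto dest!: inj_onD)
qed

lemma finite_M: "finite (carrier M)"
  using M_p_group by (simp add: finite_p_group_def)

lemma card_subgroup:
  assumes "subgroup N M"
  obtains i where "card N = p ^ i"
proof -
  obtain k where "order M = p ^ k" using M_p_group by (auto simp: finite_p_group_def)
  then have "card N dvd p ^ k" using M.lagrange[OF assms] by (metis dvd_triv_right)
  then show ?thesis using prime_p divides_primepow_nat that by blast
qed

lemma card_cosets_subgroup:
  assumes N: "subgroup N M" and H: "subgroup H M" and "H \<subseteq> N"
  shows "card (rcosets\<^bsub>M\<lparr>carrier := N\<rparr>\<^esub> H) * card H = card N"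
    and "H \<noteq> N \<Longrightarrow> p dvd card (rcosets\<^bsub>M\<lparr>carrier := N\<rparr>\<^esub> H)"
proof -
  interpret N: group "M\<lparr>carrier := N\<rparr>" using M.subgroup_imp_group[OF N] .
  show lag: "card (rcosets\<^bsub>M\<lparr>carrier := N\<rparr>\<^esub> H) * card H = card N"
    using N.lagrange[OF M.subgroup_incl[OF H N]] assms by (simp add: order_def)
  assume "H \<noteq> N"
  have fin: "finite N" using N finite_M by (meson finite_subset subgroup.subset)
  obtain i where i: "card N = p ^ i" by (rule card_subgroup[OF N])
  have "card (rcosets\<^bsub>M\<lparr>carrier := N\<rparr>\<^esub> H) dvd p ^ i" using lag i by (metis dvd_triv_left)
  then obtain j where j: "card (rcosets\<^bsub>M\<lparr>carrier := N\<rparr>\<^esub> H) = p ^ j"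
    using prime_p divides_primepow_nat by blast
  have "j \<noteq> 0"
  proof
    assume "j = 0"
    then have "card H = card N" using lag j by simp
    then show False using card_subset_eq[OF fin \<open>H \<subseteq> N\<close>] \<open>H \<noteq> N\<close> by simp
  qed
  then show "p dvd card (rcosets\<^bsub>M\<lparr>carrier := N\<rparr>\<^esub> H)" using j by simp
qed

text \<open>The number of cosets of \<open>H\<close> in \<open>N\<close> is divisible by
  \<open>p\<close>, hence so is the number of those fixed by \<open>P\<close>. The coset
  \<open>H\<close> is one of them, so there is a second one, \<open>H x\<close>, and its being fixed
  means that all \<open>[g, x]\<close> lie in \<open>H\<close>.\<close>

lemma ex_fixed_coset:
  assumes N: "invariant_subgroup P M \<phi> N" and H: "invariant_subgroup P M \<phi> H" and "H \<subset> N"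
  shows "\<exists>x\<in>N - H. \<forall>g\<in>carrier P. \<phi> g x \<otimes>\<^bsub>M\<^esub> inv\<^bsub>M\<^esub> x \<in> H"
proof -
  have sub: "subgroup N M" "subgroup H M" using N H by (auto simp: invariant_subgroup_def)
  interpret N: subgroup N M by (rule sub)
  interpret H: subgroup H M by (rule sub)
  let ?U = "rcosets\<^bsub>M\<lparr>carrier := N\<rparr>\<^esub> H"
  have U: "?U = (\<lambda>x. H #>\<^bsub>M\<^esub> x) ` N" by (auto simp: RCOSETS_def r_coset_def)
  have coset: "\<phi> g ` (H #>\<^bsub>M\<^esub> x) = H #>\<^bsub>M\<^esub> \<phi> g x" if "g \<in> carrier P" "x \<in> N" for g x
  proof -
    have "\<phi> g ` H = H"
    proof (rule card_subset_eq)
      show "finite H" using finite_M H.subset by (rule finite_subset[rotated])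
      show "\<phi> g ` H \<subseteq> H" using H that by (auto simp: invariant_subgroup_def)
      show "card (\<phi> g ` H) = card H"
        using act_inj[OF that(1)] H.subset by (intro card_image) (rule inj_on_subset)
    qed
    moreover have "\<phi> g ` (H #>\<^bsub>M\<^esub> x) = (\<lambda>h. h \<otimes>\<^bsub>M\<^esub> \<phi> g x) ` \<phi> g ` H"
      using that by (auto simp: r_coset_def act_mult image_iff)
    ultimately show ?thesis by (auto simp: r_coset_def)
  qed
  interpret act: group_action P ?U "\<lambda>g. \<lambda>C\<in>?U. \<phi> g ` C"
  proof (rule group_actionI)
    show "group P" by (rule P.is_group)
  next
    fix g C assume "g \<in> carrier P" "C \<in> ?U"
    then show "\<phi> g ` C \<in> ?U" using N by (auto simp: U coset invariant_subgroup_def)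
  next
    fix C assume "C \<in> ?U"
    then have "C \<subseteq> carrier M" using H.subset N.subset by (auto simp: U r_coset_def)
    then show "\<phi> \<one>\<^bsub>P\<^esub> ` C = C" by (force simp: act_one image_iff)
  next
    fix g h C assume "g \<in> carrier P" "h \<in> carrier P" "C \<in> ?U"
    moreover from \<open>C \<in> ?U\<close> have "C \<subseteq> carrier M"
      using H.subset N.subset by (auto simp: U r_coset_def)
    ultimately show "\<phi> (g \<otimes>\<^bsub>P\<^esub> h) ` C = \<phi> g ` \<phi> h ` C"
      unfolding image_image by (intro image_cong) (auto intro!: act_compose)
  qed
  have fin: "finite ?U"
    using finite_M N.subset by (auto simp: U intro: finite_subset)
  define F where "F = {C\<in>?U. \<forall>g\<in>carrier P. (\<lambda>C\<in>?U. \<phi> g ` C) C = C}"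
  obtain k where k: "order P = p ^ k" using P_p_group by (auto simp: finite_p_group_def)
  have "p dvd card F"
    unfolding F_def act.p_group_fixed_points_dvd[OF prime_p k fin]
    using card_cosets_subgroup(2)[OF sub] \<open>H \<subset> N\<close> by auto
  moreover have HF: "H \<in> F"
  proof -
    have H1: "H #>\<^bsub>M\<^esub> \<one>\<^bsub>M\<^esub> = H" using M.coset_mult_one[OF H.subset] .
    have "H \<in> ?U" unfolding U using N.one_closed H1 by (intro image_eqI[of _ _ "\<one>\<^bsub>M\<^esub>"]) auto
    moreover have "\<phi> g ` H = H" if "g \<in> carrier P" for g
      using coset[OF that N.one_closed] that H1 by simp
    ultimately show ?thesis by (simp add: F_def)
  qed
  moreover have "finite F" using fin by (simp add: F_def)
  ultimately have "F \<noteq> {H}"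
    using prime_p by (metis card_1_singleton_iff nat_dvd_1_iff_1 not_prime_1 One_nat_def)
  then obtain C where C: "C \<in> F" "C \<noteq> H" using HF by blast
  then obtain x where x: "x \<in> N" "C = H #>\<^bsub>M\<^esub> x" by (auto simp: F_def U)
  have "x \<notin> H" using C x by (auto simp: M.coset_join2[OF _ sub(2)])
  moreover have "\<phi> g x \<otimes>\<^bsub>M\<^esub> inv\<^bsub>M\<^esub> x \<in> H" if g: "g \<in> carrier P" for g
  proof -
    have "H #>\<^bsub>M\<^esub> \<phi> g x = H #>\<^bsub>M\<^esub> x"
      using C g coset[OF g x(1)] x by (auto simp: F_def)
    then have "\<phi> g x \<in> H #>\<^bsub>M\<^esub> x"
      using M.rcos_self[OF _ sub(2), of "\<phi> g x"] g x by auto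
    then obtain h where "h \<in> H" "\<phi> g x = h \<otimes>\<^bsub>M\<^esub> x" by (auto simp: r_coset_def)
    then show ?thesis using x by (simp add: M.m_assoc)
  qed
  ultimately show ?thesis using x by blast
qed

text \<open>\<open>C\<close> below is the preimage in \<open>N\<close> of the fixed points of \<open>P\<close> on \<open>N / H\<close>. For a maximal
  proper invariant subgroup \<open>H\<close> it must be all of \<open>N\<close>.\<close>

lemma action_commutator_psubset:
  assumes N: "invariant_subgroup P M \<phi> N" and "N \<noteq> {\<one>\<^bsub>M\<^esub>}"
  shows "action_commutator P M \<phi> N \<subset> N"
proof -
  have sub: "subgroup N M" using N by (auto simp: invariant_subgroup_def)
  interpret N: subgroup N M by (rule sub)
  let ?S = "{H. invariant_subgroup P M \<phi> H \<and> H \<subset> N}"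
  have "finite ?S"
  proof (rule finite_subset)
    show "?S \<subseteq> Pow (carrier M)" using N.subset by auto
  qed (simp add: finite_M)
  \<comment> \<open>The trivial subgroup is invariant and proper, so a maximal proper invariant
    subgroup exists.\<close>
  moreover have "{\<one>\<^bsub>M\<^esub>} \<in> ?S"
    using assms(2) N.one_closed M.triv_subgroup by (auto simp: invariant_subgroup_def)
  ultimately have "\<exists>H\<in>?S. \<forall>H'\<in>?S. H \<subseteq> H' \<longrightarrow> H = H'"
    by (intro finite_has_maximal) auto
  then obtain H where H: "H \<in> ?S" and max: "\<forall>H'\<in>?S. H \<subseteq> H' \<longrightarrow> H = H'"
    by (rule bexE)
  from H have subH: "subgroup H M" and HN: "H \<subset> N"
    and Hinv: "\<And>g x. g \<in> carrier P \<Longrightarrow> x \<in> H \<Longrightarrow> \<phi> g x \<in> H"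
    by (auto simp: invariant_subgroup_def)
  interpret H: subgroup H M by (rule subH)
  define C where "C = {y\<in>N. \<forall>g\<in>carrier P. \<phi> g y \<otimes>\<^bsub>M\<^esub> inv\<^bsub>M\<^esub> y \<in> H}"
  have "subgroup C M"
  proof (rule M.subgroupI)
    show "C \<subseteq> carrier M" by (auto simp: C_def)
    show "C \<noteq> {}" using N.one_closed by (auto simp: C_def intro!: exI[of _ "\<one>\<^bsub>M\<^esub>"])
  next
    fix a assume a: "a \<in> C"
    have "\<phi> g (inv\<^bsub>M\<^esub> a) \<otimes>\<^bsub>M\<^esub> inv\<^bsub>M\<^esub> (inv\<^bsub>M\<^esub> a) \<in> H" if g: "g \<in> carrier P" for g
    proof -
      have "\<phi> g (inv\<^bsub>M\<^esub> a) \<otimes>\<^bsub>M\<^esub> inv\<^bsub>M\<^esub> (inv\<^bsub>M\<^esub> a) = inv\<^bsub>M\<^esub> (\<phi> g a \<otimes>\<^bsub>M\<^esub> inv\<^bsub>M\<^esub> a)"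
        using a g by (auto simp: C_def act_inv M.inv_mult)
      then show ?thesis using a g by (auto simp: C_def)
    qed
    then show "inv\<^bsub>M\<^esub> a \<in> C" using a by (auto simp: C_def)
  next
    fix a b assume ab: "a \<in> C" "b \<in> C"
    have "\<phi> g (a \<otimes>\<^bsub>M\<^esub> b) \<otimes>\<^bsub>M\<^esub> inv\<^bsub>M\<^esub> (a \<otimes>\<^bsub>M\<^esub> b) \<in> H" if g: "g \<in> carrier P" for g
    proof -
      have "\<phi> g (a \<otimes>\<^bsub>M\<^esub> b) \<otimes>\<^bsub>M\<^esub> inv\<^bsub>M\<^esub> (a \<otimes>\<^bsub>M\<^esub> b)
          = (\<phi> g a \<otimes>\<^bsub>M\<^esub> inv\<^bsub>M\<^esub> a) \<otimes>\<^bsub>M\<^esub> (\<phi> g b \<otimes>\<^bsub>M\<^esub> inv\<^bsub>M\<^esub> b)"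
        using ab g by (auto simp: C_def act_mult M.inv_mult M.m_ac)
      then show ?thesis using ab g by (auto simp: C_def)
    qed
    then show "a \<otimes>\<^bsub>M\<^esub> b \<in> C" using ab by (auto simp: C_def)
  qed
  moreover have "\<phi> h y \<in> C" if h: "h \<in> carrier P" and y: "y \<in> C" for h y
  proof -
    have yN: "y \<in> N" "\<phi> h y \<in> N" using y h N by (auto simp: C_def invariant_subgroup_def)
    have "\<phi> g (\<phi> h y) \<otimes>\<^bsub>M\<^esub> inv\<^bsub>M\<^esub> \<phi> h y \<in> H" if g: "g \<in> carrier P" for g
    proof -
      have cl: "\<phi> g (\<phi> h y) \<in> carrier M" "\<phi> h y \<in> carrier M" "y \<in> carrier M" using g h yN by auto
      \<comment> \<open>The commutator of \<open>g\<close> with \<open>\<phi> h y\<close> is the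
        quotient of the commutators of \<open>gh\<close> and of \<open>h\<close> with
        \<open>y\<close>, both of which lie in \<open>H\<close>.\<close>
      have "(\<phi> (g \<otimes>\<^bsub>P\<^esub> h) y \<otimes>\<^bsub>M\<^esub> inv\<^bsub>M\<^esub> y) \<otimes>\<^bsub>M\<^esub> inv\<^bsub>M\<^esub> (\<phi> h y \<otimes>\<^bsub>M\<^esub> inv\<^bsub>M\<^esub> y)
          = (\<phi> g (\<phi> h y) \<otimes>\<^bsub>M\<^esub> inv\<^bsub>M\<^esub> y) \<otimes>\<^bsub>M\<^esub> (y \<otimes>\<^bsub>M\<^esub> inv\<^bsub>M\<^esub> \<phi> h y)"
        using g h cl by (simp only: act_compose M.inv_mult_group M.inv_inv M.inv_closed)
      also have "\<dots> = \<phi> g (\<phi> h y) \<otimes>\<^bsub>M\<^esub> (inv\<^bsub>M\<^esub> y \<otimes>\<^bsub>M\<^esub> y) \<otimes>\<^bsub>M\<^esub> inv\<^bsub>M\<^esub> \<phi> h y"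
        using cl by (simp only: M.m_assoc M.m_closed M.inv_closed)
      also have "\<dots> = \<phi> g (\<phi> h y) \<otimes>\<^bsub>M\<^esub> inv\<^bsub>M\<^esub> \<phi> h y" using cl by simp
      finally have "\<phi> g (\<phi> h y) \<otimes>\<^bsub>M\<^esub> inv\<^bsub>M\<^esub> \<phi> h y
          = (\<phi> (g \<otimes>\<^bsub>P\<^esub> h) y \<otimes>\<^bsub>M\<^esub> inv\<^bsub>M\<^esub> y) \<otimes>\<^bsub>M\<^esub> inv\<^bsub>M\<^esub> (\<phi> h y \<otimes>\<^bsub>M\<^esub> inv\<^bsub>M\<^esub> y)" ..
      moreover have "\<phi> k y \<otimes>\<^bsub>M\<^esub> inv\<^bsub>M\<^esub> y \<in> H" if "k \<in> carrier P" for k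
        using y that by (auto simp: C_def)
      ultimately show ?thesis using g h by simp
    qed
    then show ?thesis using yN by (auto simp: C_def)
  qed
  ultimately have "invariant_subgroup P M \<phi> C" by (auto simp: invariant_subgroup_def)
  moreover have "H \<subseteq> C" using HN Hinv by (auto simp: C_def)
  moreover have "C \<noteq> H" using ex_fixed_coset[OF N _ HN] H by (auto simp: C_def)
  moreover have "C \<subseteq> N" by (auto simp: C_def)
  ultimately have "C = N" using bspec[OF max, of C] by blast
  then have "action_commutator P M \<phi> N \<subseteq> H"
    unfolding action_commutator_def
    by (intro M.generate_subgroup_incl subH) (auto simp: C_def)
  then show ?thesis using HN by blast
qed

text \<open>As \<open>M\<close> is abelian, mapping \<open>x\<close> to \<open>[g, x]\<close> is a
  homomorphism on \<open>N\<close>. Its image lies in \<open>[P, N]\<close> and its kernel consists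
  of fixed points of \<open>g\<close>, so \<open>card N\<close> is the product of an order at most
  that of \<open>[P, N]\<close> and one at most \<open>p\<close>.\<close>

lemma card_le_action_commutator:
  assumes N: "invariant_subgroup P M \<phi> N" and g: "g \<in> carrier P"
    and fix_le: "card {x\<in>carrier M. \<phi> g x = x} \<le> p"
  shows "card N \<le> p * card (action_commutator P M \<phi> N)"
proof -
  have sub: "subgroup N M" using N by (auto simp: invariant_subgroup_def)
  interpret N: subgroup N M by (rule sub)
  let ?N = "M\<lparr>carrier := N\<rparr>"
  let ?K = "action_commutator P M \<phi> N"
  interpret NG: group ?N using M.subgroup_imp_group[OF sub] .
  let ?f = "\<lambda>x. \<phi> g x \<otimes>\<^bsub>M\<^esub> inv\<^bsub>M\<^esub> x"
  have "?f \<in> hom ?N M"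
    by (rule homI) (use g in \<open>auto simp: act_mult M.inv_mult M.m_ac\<close>)
  then interpret f: group_hom ?N M ?f by unfold_locales
  have "card (?f ` N) * card (kernel ?N M ?f) = card N"
    using f.card_image_mult_card_kernel by (simp add: order_def)
  moreover have "card (kernel ?N M ?f) \<le> p"
  proof (rule le_trans[OF card_mono fix_le])
    show "finite {x\<in>carrier M. \<phi> g x = x}" using finite_M by simp
    show "kernel ?N M ?f \<subseteq> {x\<in>carrier M. \<phi> g x = x}"
      using g by (auto simp: kernel_def) (metis M.inv_closed M.inv_equality M.inv_inv N.mem_carrier act_closed)
  qed
  moreover have "card (?f ` N) \<le> card ?K"
  proof (rule card_mono)
    have "{\<phi> g x \<otimes>\<^bsub>M\<^esub> inv\<^bsub>M\<^esub> x |g x. g \<in> carrier P \<and> x \<in> N} \<subseteq> carrier M" by auto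
    then show "finite ?K"
      unfolding action_commutator_def
      by (meson M.generate_in_carrier finite_M finite_subset subsetI)
    show "?f ` N \<subseteq> ?K" using g by (auto simp: action_commutator_def intro!: generate.incl)
  qed
  ultimately show ?thesis
    using mult_le_mono[of "card (?f ` N)" "card ?K" "card (kernel ?N M ?f)" p]
    by (simp add: mult.commute)
qed

text \<open>The index of \<open>[P, N]\<close> in \<open>N\<close> is a multiple of \<open>p\<close>
  by \<open>action_commutator_psubset\<close> and at most \<open>p\<close> by
  \<open>card_le_action_commutator\<close>.\<close>

lemma uniserial_actionI:
  assumes g: "g \<in> carrier P" and fix_le: "card {x\<in>carrier M. \<phi> g x = x} \<le> p"
  shows "uniserial_action p P M \<phi>"
proof -
  have "card (rcosets\<^bsub>M\<lparr>carrier := N\<rparr>\<^esub> (action_commutator P M \<phi> N)) = p"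
    if N: "invariant_subgroup P M \<phi> N" and "N \<noteq> {\<one>\<^bsub>M\<^esub>}" for N
  proof -
    let ?K = "action_commutator P M \<phi> N"
    have sub: "subgroup N M" using N by (auto simp: invariant_subgroup_def)
    interpret N: subgroup N M by (rule sub)
    have subK: "subgroup ?K M"
      unfolding action_commutator_def by (rule M.generate_is_subgroup) auto
    have KN: "?K \<subset> N" using action_commutator_psubset that by blast
    have "0 < card ?K"
      using subK finite_M by (rule subgroup.finite_imp_card_positive)
    then have "card (rcosets\<^bsub>M\<lparr>carrier := N\<rparr>\<^esub> ?K) \<le> p"
      using card_le_action_commutator[OF N g fix_le] card_cosets_subgroup(1)[OF sub subK] KN
      by (metis mult_le_cancel2 psubset_imp_subset)
    moreover have "p dvd card (rcosets\<^bsub>M\<lparr>carrier := N\<rparr>\<^esub> ?K)"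
      using card_cosets_subgroup(2)[OF sub subK] KN by blast
    moreover have "0 < card (rcosets\<^bsub>M\<lparr>carrier := N\<rparr>\<^esub> ?K)"
      using card_cosets_subgroup(1)[OF sub subK] KN
        subgroup.finite_imp_card_positive[OF sub finite_M]
      by (metis mult_0 not_gr_zero psubset_imp_subset)
    ultimately show ?thesis by (meson dvd_imp_le le_antisym)
  qed
  then show ?thesis
    using P_p_group M_p_group M_comm \<phi>_hom by (simp add: uniserial_action_def)
qed

end

section \<open>Conjugation action of a quotient on an abelian normal subgroup\<close>

text \<open>The criterion \<open>uniserial_actionI\<close> is applied to the element of
  \<open>P\<close> that \<open>\<psi>\<close> maps to the coset of \<open>s\<close>: its fixed
  points are the elements of \<open>B\<close> centralized by \<open>s\<close>.\<close>

lemma uniserial_coset_conj: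
  fixes G (structure)
  assumes G: "finite_p_group p G" and normal: "B \<lhd> G" and comm: "comm_group (G\<lparr>carrier := B\<rparr>)"
    and s: "s \<in> carrier G" and centralizer: "card {b\<in>B. s \<otimes> b \<otimes> inv s = b} \<le> p"
    and P: "group P" and \<psi>: "\<psi> \<in> iso P (G Mod B)"
  shows "uniserial_action p P (G\<lparr>carrier := B\<rparr>) (\<lambda>g. coset_conj G B (\<psi> g))"
proof -
  interpret normal B G by (rule normal)
  interpret P: group P by (rule P)
  let ?B = "G\<lparr>carrier := B\<rparr>"
  let ?\<phi> = "\<lambda>g. coset_conj G B (\<psi> g)"
  have fin: "finite (carrier G)" and "prime p" using G by (auto simp: finite_p_group_def)
  obtain k where k: "order G = p ^ k" using G by (auto simp: finite_p_group_def)
  have p_power: "\<exists>i. n = p ^ i" if "n dvd p ^ k" for n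
    using that \<open>prime p\<close> divides_primepow_nat by blast
  have lag: "card (rcosets B) * card B = p ^ k" using lagrange[OF is_subgroup] k by simp
  have \<psi>_bij: "bij_betw \<psi> (carrier P) (rcosets B)" and \<psi>_hom: "\<psi> \<in> hom P (G Mod B)"
    using \<psi> by (auto simp: iso_def FactGroup_def)
  have rep: "\<exists>h\<in>carrier G. h \<in> \<psi> g \<and> \<psi> g = B #> h" if "g \<in> carrier P" for g
    using bij_betwE[OF \<psi>_bij] that rcos_self is_subgroup by (fastforce simp: RCOSETS_def)
  have coset: "\<psi> g \<in> carrier (G Mod B)" if "g \<in> carrier P" for g
    using \<psi>_hom that by (auto simp: hom_def)
  have conj: "?\<phi> g x = h \<otimes> x \<otimes> inv h" if "g \<in> carrier P" "h \<in> \<psi> g" "x \<in> B" for g h x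
    by (rule coset_conj_eq[OF normal comm coset]) (use that in auto)
  have auto: "?\<phi> g \<in> auto ?B" if g: "g \<in> carrier P" for g
  proof -
    obtain h where h: "h \<in> carrier G" "h \<in> \<psi> g" using rep[OF g] by blast
    have cl: "?\<phi> g x \<in> B" if "x \<in> B" for x
      using that h by (simp add: conj[OF g h(2)] inv_op_closed2)
    have "inj_on (?\<phi> g) B"
    proof (rule inj_onI)
      fix x y assume xy: "x \<in> B" "y \<in> B" "?\<phi> g x = ?\<phi> g y"
      then have "h \<otimes> x \<otimes> inv h = h \<otimes> y \<otimes> inv h" by (simp add: conj[OF g h(2)])
      then show "x = y" using conjugation_is_inj[OF h(1), of x y] xy by auto
    qed
    moreover have "finite B" using fin subset by (rule finite_subset[rotated])
    ultimately have "bij_betw (?\<phi> g) B B"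
      using cl endo_inj_surj[of B "?\<phi> g"] by (auto simp: bij_betw_def)
    moreover have "?\<phi> g (x \<otimes> y) = ?\<phi> g x \<otimes> ?\<phi> g y" if xy: "x \<in> B" "y \<in> B" for x y
    proof -
      have "(h \<otimes> x \<otimes> inv h) \<otimes> (h \<otimes> y \<otimes> inv h) = h \<otimes> x \<otimes> (inv h \<otimes> h) \<otimes> y \<otimes> inv h"
        using xy h by (simp only: m_assoc m_closed inv_closed mem_carrier)
      then show ?thesis using xy h by (simp add: conj[OF g h(2)] m_assoc)
    qed
    ultimately show ?thesis
      using cl by (auto simp: auto_def hom_def Bij_def coset_conj_def)
  qed
  have hom: "?\<phi> \<in> hom P (AutoGroup ?B)"
  proof (rule homI)
    fix g assume "g \<in> carrier P"
    then show "?\<phi> g \<in> carrier (AutoGroup ?B)" using auto by (simp add: AutoGroup_def)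
  next
    fix g g' assume g: "g \<in> carrier P" "g' \<in> carrier P"
    obtain h h' where h: "h \<in> carrier G" "h \<in> \<psi> g" "h' \<in> carrier G" "h' \<in> \<psi> g'"
      using rep g by meson
    have "\<psi> (g \<otimes>\<^bsub>P\<^esub> g') = \<psi> g <#> \<psi> g'"
      using \<psi>_hom g by (auto simp: hom_def FactGroup_def)
    then have hh: "h \<otimes> h' \<in> \<psi> (g \<otimes>\<^bsub>P\<^esub> g')" using h by (auto simp: set_mult_def)
    have "?\<phi> (g \<otimes>\<^bsub>P\<^esub> g') = compose B (?\<phi> g) (?\<phi> g')"
    proof (rule extensionalityI[of _ B])
      fix x assume x: "x \<in> B"
      have "?\<phi> g' x \<in> B" using h x by (simp add: conj[OF g(2) h(4)] inv_op_closed2)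
      then show "?\<phi> (g \<otimes>\<^bsub>P\<^esub> g') x = compose B (?\<phi> g) (?\<phi> g') x"
        using x h g by (simp add: compose_def conj[OF _ hh] conj[OF g(1) h(2)] conj[OF g(2) h(4)]
            inv_mult_group m_assoc)
    qed (auto simp: coset_conj_def compose_def)
    then show "?\<phi> (g \<otimes>\<^bsub>P\<^esub> g') = ?\<phi> g \<otimes>\<^bsub>AutoGroup ?B\<^esub> ?\<phi> g'"
      using auto[OF g(1)] auto[OF g(2)] by (simp add: AutoGroup_def BijGroup_def auto_def)
  qed
  have "finite_p_group p P"
  proof -
    have "order P = card (rcosets B)"
      using bij_betw_same_card[OF \<psi>_bij] by (simp add: order_def)
    then have "order P dvd p ^ k" using lag by (metis dvd_triv_left)
    moreover have "finite (carrier P)"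
      using bij_betw_finite[OF \<psi>_bij] fin rcosets_part_G[OF is_subgroup] by (metis finite_UnionD)
    ultimately show ?thesis using P p_power \<open>prime p\<close> by (auto simp: finite_p_group_def)
  qed
  moreover have "finite_p_group p ?B"
  proof -
    have "card B dvd p ^ k" using lag by (metis dvd_triv_right)
    then show ?thesis
      using p_power \<open>prime p\<close> subgroup_imp_group[OF is_subgroup] fin subset
      by (auto simp: finite_p_group_def order_def intro: finite_subset)
  qed
  ultimately interpret p_module p P ?B ?\<phi>
    using comm hom by (intro p_module.intro)
  have "B #> s \<in> rcosets B" using s by (auto simp: RCOSETS_def)
  then obtain g where g: "g \<in> carrier P" "\<psi> g = B #> s"
    using \<psi>_bij by (metis bij_betw_def imageE)
  then have "s \<in> \<psi> g" using rcos_self[OF s is_subgroup] by simp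
  then have "{x \<in> carrier ?B. ?\<phi> g x = x} = {b\<in>B. s \<otimes> b \<otimes> inv s = b}"
    using conj[OF g(1)] by auto
  then show ?thesis using uniserial_actionI[OF g(1)] centralizer by simp
qed

section \<open>Characteristic subgroups: normality and transport along isomorphisms\<close>

text \<open>Inner automorphisms, made extensional by restriction to the carrier, belong to
  \<open>auto G\<close>.\<close>

lemma characteristic_subgroup_normal:
  fixes G (structure)
  assumes "group G" and char: "characteristic_subgroup B G"
  shows "B \<lhd> G"
proof -
  interpret group G by fact
  have "subgroup B G" using char by (simp add: characteristic_subgroup_def)
  then interpret B: subgroup B G .
  have "x \<otimes> b \<otimes> inv x \<in> B" if x: "x \<in> carrier G" and b: "b \<in> B" for x b
  proof -
    have "(\<lambda>h\<in>carrier G. x \<otimes> h \<otimes> inv x) \<in> auto G"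
    proof -
      have "(\<lambda>h\<in>carrier G. x \<otimes> h \<otimes> inv x) \<in> Bij (carrier G)"
        using conjugation_is_bij[OF x] by (simp add: Bij_def)
      moreover have "(\<lambda>h\<in>carrier G. x \<otimes> h \<otimes> inv x) \<in> hom G G"
      proof (rule homI)
        fix a c assume ac: "a \<in> carrier G" "c \<in> carrier G"
        have "(x \<otimes> a \<otimes> inv x) \<otimes> (x \<otimes> c \<otimes> inv x) = x \<otimes> a \<otimes> (inv x \<otimes> x) \<otimes> c \<otimes> inv x"
          using x ac by (simp only: m_assoc m_closed inv_closed)
        then show "(\<lambda>h\<in>carrier G. x \<otimes> h \<otimes> inv x) (a \<otimes> c) =
            (\<lambda>h\<in>carrier G. x \<otimes> h \<otimes> inv x) a \<otimes> (\<lambda>h\<in>carrier G. x \<otimes> h \<otimes> inv x) c"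
          using x ac by (simp add: m_assoc)
      qed (use x in auto)
      ultimately show ?thesis by (simp add: auto_def)
    qed
    then have "(\<lambda>h\<in>carrier G. x \<otimes> h \<otimes> inv x) ` B = B"
      using char unfolding characteristic_subgroup_def by blast
    then show ?thesis using b by (metis (no_types, lifting) B.mem_carrier image_eqI restrict_apply')
  qed
  then show ?thesis using \<open>subgroup B G\<close> by (simp add: normal_inv_iff)
qed

lemma characteristic_subgroup_iso_image:
  assumes "group G" "group H" and f: "f \<in> iso G H" and char: "characteristic_subgroup B G"
  shows "characteristic_subgroup (f ` B) H"
proof -
  interpret G: group G by fact
  interpret H: group H by fact
  interpret f: group_hom G H f using f by unfold_locales (simp add: iso_def)
  have f_inj: "inj_on f (carrier G)" and f_surj: "f ` carrier G = carrier H"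
    using f by (auto simp: iso_iff)
  define f' where "f' = inv_into (carrier G) f"
  have f': "f' \<in> iso H G" unfolding f'_def by (rule G.iso_set_sym[OF f])
  have ff': "f (f' y) = y" if "y \<in> carrier H" for y
    using that f_surj by (simp add: f'_def f_inv_into_f)
  have f'f: "f' (f x) = x" if "x \<in> carrier G" for x
    using that f_inj by (simp add: f'_def)
  have sub: "subgroup B G" using char by (simp add: characteristic_subgroup_def)
  have B: "B \<subseteq> carrier G" using sub by (rule subgroup.subset)
  have "\<alpha> ` f ` B = f ` B" if \<alpha>: "\<alpha> \<in> auto H" for \<alpha>
  proof -
    define \<beta> where "\<beta> = (\<lambda>x\<in>carrier G. f' (\<alpha> (f x)))"
    have "\<alpha> \<in> iso H H" using \<alpha> by (auto simp: auto_def iso_def Bij_def)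
    then have "f' \<circ> (\<alpha> \<circ> f) \<in> iso G G" 
      using iso_set_trans[OF iso_set_trans[OF f] f'] by blast
    then have "restrict (f' \<circ> (\<alpha> \<circ> f)) (carrier G) \<in> iso G G"
      using G.hom_restrict[of "f' \<circ> (\<alpha> \<circ> f)" G "restrict (f' \<circ> (\<alpha> \<circ> f)) (carrier G)"]
      by (simp add: iso_def del: G.restrict_hom_iff)
    then have "\<beta> \<in> iso G G" by (simp add: \<beta>_def comp_def)
    then have "\<beta> \<in> auto G" by (auto simp: auto_def iso_def Bij_def \<beta>_def)
    then have "\<beta> ` B = B" using char by (auto simp: characteristic_subgroup_def)
    moreover have "\<alpha> (f x) = f (\<beta> x)" if "x \<in> B" for x
    proof -
      have "f x \<in> carrier H" using that B by auto
      then have "\<alpha> (f x) \<in> carrier H" using \<alpha> by (auto simp: auto_def hom_def)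
      then show ?thesis using that B by (auto simp: \<beta>_def ff')
    qed
    then have "\<alpha> ` f ` B = f ` \<beta> ` B" unfolding image_image by (intro image_cong) auto
    ultimately show ?thesis by simp
  qed
  then show ?thesis
    using f.subgroup_img_is_subgroup[OF sub] by (simp add: characteristic_subgroup_def)
qed

section \<open>Permutation groups\<close>

text \<open>This is \<open>sym_group\<close> over an arbitrary set of points: the wreath product
  acts on pairs of a block and a residue, its quotient on pairs of a block and a unit.\<close>

definition perm_group :: "'a set \<Rightarrow> ('a \<Rightarrow> 'a) monoid" where
  "perm_group A = \<lparr>carrier = {f. f permutes A}, monoid.mult = (\<circ>), one = id\<rparr>"

lemma sym_group_eq_perm_group: "sym_group n = perm_group {1..n}"
  by (simp add: sym_group_def perm_group_def)

lemma perm_group_simps [simp]: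
  "carrier (perm_group A) = {f. f permutes A}" "monoid.mult (perm_group A) = (\<circ>)"
  "one (perm_group A) = id"
  by (simp_all add: perm_group_def)

lemma group_perm_group: "group (perm_group A)"
proof (rule groupI)
  fix f assume "f \<in> carrier (perm_group A)"
  then have "Hilbert_Choice.inv f \<in> carrier (perm_group A)"
    "Hilbert_Choice.inv f \<otimes>\<^bsub>perm_group A\<^esub> f = \<one>\<^bsub>perm_group A\<^esub>"
    by (simp_all add: permutes_inv permutes_inv_o)
  then show "\<exists>g\<in>carrier (perm_group A). g \<otimes>\<^bsub>perm_group A\<^esub> f = \<one>\<^bsub>perm_group A\<^esub>" by blast
qed (auto simp: permutes_compose permutes_id comp_assoc)

lemma inv_perm_group:
  assumes "f permutes A"
  shows "inv\<^bsub>perm_group A\<^esub> f = Hilbert_Choice.inv f"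
  using assms
  by (intro group.inv_equality[OF group_perm_group]) (simp_all add: permutes_inv permutes_inv_o)

lemma order_perm_group: "finite A \<Longrightarrow> order (perm_group A) = fact (card A)"
  by (simp add: order_def card_permutations)

lemma perm_group_iso:
  assumes f: "bij_betw f A A'"
  shows "map_permutation A f \<in> iso (perm_group A) (perm_group A')"
proof -
  have inj: "inj_on f A" and im: "f ` A = A'" using f by (auto simp: bij_betw_def)
  have "map_permutation A f \<in> hom (perm_group A) (perm_group A')"
  proof (rule homI)
    fix p q assume pq: "p \<in> carrier (perm_group A)" "q \<in> carrier (perm_group A)"
    have "map_permutation A f (p \<circ> q) x = map_permutation A f p (map_permutation A f q x)" for x
    proof (cases "x \<in> A'")
      case True
      then obtain a where a: "a \<in> A" "x = f a" using im by auto
      then have "q a \<in> A" using pq by (simp add: permutes_in_image)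
      then show ?thesis using a by (simp add: map_permutation_apply[OF inj])
    next
      case False
      then have "map_permutation A f r x = x" if "r permutes A" for r
        using map_permutation_permutes[OF f that] by (simp add: permutes_not_in)
      then show ?thesis using pq by (simp add: permutes_compose)
    qed
    then show "map_permutation A f (p \<otimes>\<^bsub>perm_group A\<^esub> q) =
        map_permutation A f p \<otimes>\<^bsub>perm_group A'\<^esub> map_permutation A f q"
      by (simp add: fun_eq_iff)
  qed (simp add: map_permutation_permutes[OF f])
  moreover have "bij_betw (map_permutation A f) {p. p permutes A} {p. p permutes A'}"
  proof (rule bij_betw_byWitness[where f' = "map_permutation A' (inv_into A f)"])
    have f': "bij_betw (inv_into A f) A' A" using f by (rule bij_betw_inv_into)
    show "\<forall>p\<in>{p. p permutes A}. map_permutation A' (inv_into A f) (map_permutation A f p) = p"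
      using map_permutation_compose_inv[OF f] inj by simp
    show "\<forall>p\<in>{p. p permutes A'}. map_permutation A f (map_permutation A' (inv_into A f) p) = p"
      using map_permutation_compose_inv[OF f'] f by (simp add: bij_betw_inv_into_right)
    show "map_permutation A f ` {p. p permutes A} \<subseteq> {p. p permutes A'}"
      using map_permutation_permutes[OF f] by auto
    show "map_permutation A' (inv_into A f) ` {p. p permutes A'} \<subseteq> {p. p permutes A}"
      using map_permutation_permutes[OF f'] by auto
  qed
  ultimately show ?thesis by (simp add: iso_def)
qed

text \<open>A subgroup whose order is the full power of \<open>p\<close> in \<open>(p ^ m)!\<close>
  is Sylow. Relabelling the points carries it into \<open>sym_group (p ^ m)\<close>, where any two
  Sylow subgroups are isomorphic.\<close>

lemma iso_is_P:
  assumes S: "subgroup S (perm_group A)" and "finite A" and cA: "card A = p ^ m" and "prime p"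
    and cS: "card S = p ^ multiplicity p (fact (p ^ m) :: nat)" and Q: "is_P p m Q"
  shows "(perm_group A)\<lparr>carrier := S\<rparr> \<cong> Q"
proof -
  obtain f where f: "bij_betw f A {1..p ^ m}"
    using \<open>finite A\<close> cA by (metis card_atLeastAtMost diff_Suc_1 finite_atLeastAtMost finite_same_card_bij)
  interpret A: group "perm_group A" by (rule group_perm_group)
  interpret S: group "sym_group (p ^ m)" by (rule sym_group_is_group)
  have iso: "map_permutation A f \<in> iso (perm_group A) (sym_group (p ^ m))"
    using perm_group_iso[OF f] by (simp add: sym_group_eq_perm_group)
  let ?T = "map_permutation A f ` S"
  have "inj_on (map_permutation A f) S"
    using iso subgroup.subset[OF S] by (auto simp: iso_iff intro: inj_on_subset)
  then have cT: "card ?T = card S" by (rule card_image)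
  interpret h: group_hom "perm_group A" "sym_group (p ^ m)" "map_permutation A f"
    using iso by unfold_locales (simp add: iso_def)
  have "sylow_subgroup p ?T (sym_group (p ^ m))"
    using h.subgroup_img_is_subgroup[OF S] cT cS
    by (simp add: sylow_subgroup_def sym_group_eq_perm_group order_perm_group finite_permutations)
  then have "(sym_group (p ^ m))\<lparr>carrier := ?T\<rparr> \<cong> Q"
    using Q sylow_subgroups_iso[OF S.is_group \<open>prime p\<close>] by (auto simp: is_P_def)
  moreover have "(perm_group A)\<lparr>carrier := S\<rparr> \<cong> (sym_group (p ^ m))\<lparr>carrier := ?T\<rparr>"
    using iso_restrict[OF iso A.is_group S.is_group S] by (auto simp: is_iso_def)
  ultimately show ?thesis by (rule iso_trans[rotated])
qed

section \<open>The exponent of a prime in a factorial\<close>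

text \<open>Passing from \<open>m\<close> to \<open>Suc m\<close> adds the factors
  \<open>p * m + j\<close> with \<open>0 < j < p\<close>, which are prime to \<open>p\<close>, and
  the factor \<open>p * Suc m\<close>, which contributes one more than \<open>Suc m\<close> does.
  Through this recursion the orders of the wreath products are recognised as Sylow orders.\<close>

lemma multiplicity_fact_mult:
  assumes "prime (p :: nat)"
  shows "multiplicity p (fact (p * m) :: nat) = m + multiplicity p (fact m :: nat)"
proof (induction m)
  case (Suc m)
  have *: "j \<notin> {0<..<p} \<or> multiplicity p (p * m + j) = 0" for j
    using assms by (auto intro!: not_dvd_imp_multiplicity_0 simp: dvd_add_right_iff nat_dvd_not_less)
  have "fact (p * m + i) = fact (p * m) * (\<Prod>j=1..i. p * m + j)" for i
    by (induction i) (simp_all add: algebra_simps)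
  from this[of p] have "(fact (p * Suc m) :: nat) = fact (p * m) * (\<Prod>j=1..p. p * m + j)"
    by (simp add: add.commute)
  moreover have "{1..p} = insert p {0<..<p}"
    using prime_gt_0_nat[OF assms] by auto
  ultimately have "(fact (p * Suc m) :: nat) = fact (p * m) * (p * Suc m * (\<Prod>j\<in>{0<..<p}. p * m + j))"
    by (simp add: algebra_simps)
  moreover have "multiplicity p (\<Prod>j\<in>{0<..<p}. p * m + j) = (\<Sum>j\<in>{0<..<p}. multiplicity p (p * m + j))"
    using assms by (intro prime_elem_multiplicity_prod_distrib) auto
  moreover have "\<dots> = 0" using * by (intro sum.neutral) blast
  moreover have "(\<Prod>j\<in>{0<..<p}. p * m + j) \<noteq> 0" by auto
  moreover have "multiplicity p (p * Suc m) = Suc (multiplicity p (Suc m))"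
    using assms prime_gt_0_nat[OF assms]
    by (simp add: prime_elem_multiplicity_mult_distrib del: mult_Suc_right)
  ultimately have "multiplicity p (fact (p * Suc m) :: nat) =
      multiplicity p (fact (p * m) :: nat) + Suc (multiplicity p (Suc m))"
    using assms prime_gt_0_nat[OF assms]
    by (simp add: prime_elem_multiplicity_mult_distrib del: mult_Suc_right)
  moreover have "multiplicity p (fact (Suc m) :: nat) =
      multiplicity p (Suc m) + multiplicity p (fact m :: nat)"
    using assms by (simp only: fact_Suc of_nat_id)
      (intro prime_elem_multiplicity_mult_distrib, auto)
  ultimately show ?case using Suc by simp
qed simp

section \<open>The wreath product of an affine group with a permutation group\<close>

text \<open>By \<open>E_square\<close> every unit in \<open>E\<close> is its own inverse, so
  inverses of affine maps are given by polynomial formulas. Both \<open>{1}\<close> and, for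
  \<open>q = 4\<close>, \<open>{1, 3}\<close> satisfy this.\<close>

locale affine_wreath =
  fixes q :: int and E :: "int set" and N :: nat and V :: "(nat \<Rightarrow> nat) set"
  assumes N_pos: "0 < N" and q_gt_1: "1 < q"
    and V: "subgroup V (perm_group {..<N})"
    and E_sub: "E \<subseteq> {0..<q}" and one_E: "1 \<in> E"
    and E_mult: "e \<in> E \<Longrightarrow> e' \<in> E \<Longrightarrow> e * e' mod q \<in> E"
    and E_square: "e \<in> E \<Longrightarrow> e * e mod q = 1"
begin

text \<open>The coefficients \<open>e y\<close> and \<open>b y\<close> belong to the source block
  \<open>y\<close>, not to its image \<open>g y\<close>. Points outside
  \<open>{..<N} \<times> Z\<close> stay fixed, as \<open>permutes\<close> demands.\<close>

definition aff :: "int set \<Rightarrow> (nat \<Rightarrow> nat) \<Rightarrow> (nat \<Rightarrow> int) \<Rightarrow> (nat \<Rightarrow> int) \<Rightarrow> nat \<times> int \<Rightarrow> nat \<times> int"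
  where "aff Z g e b = (\<lambda>(y, i). if y < N \<and> i \<in> Z then (g y, (e y * i + b y) mod q) else (y, i))"

abbreviation Zq :: "int set" where "Zq \<equiv> {0..<q}"

text \<open>Only the residues of the \<open>e y\<close> are required to lie in \<open>E\<close>, so
  that products of coefficients, as they arise in \<open>aff_comp\<close>, may be left
  unreduced.\<close>

definition W :: "(nat \<times> int \<Rightarrow> nat \<times> int) set" where
  "W = {aff Zq g e b | g e b. g \<in> V \<and> (\<forall>y<N. e y mod q \<in> E)}"

abbreviation W_group :: "(nat \<times> int \<Rightarrow> nat \<times> int) monoid" where
  "W_group \<equiv> (perm_group ({..<N} \<times> Zq))\<lparr>carrier := W\<rparr>"

definition shift :: "(nat \<Rightarrow> int) \<Rightarrow> nat \<times> int \<Rightarrow> nat \<times> int" where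
  "shift b = aff Zq id (\<lambda>_. 1) b"

lemma W_I: "g \<in> V \<Longrightarrow> (\<And>y. y < N \<Longrightarrow> e y mod q \<in> E) \<Longrightarrow> aff Zq g e b \<in> W"
  by (auto simp: W_def)

lemma aff_cong:
  assumes "\<And>y. y < N \<Longrightarrow> g y = g' y" "\<And>y. y < N \<Longrightarrow> e y mod q = e' y mod q"
    and "\<And>y. y < N \<Longrightarrow> b y mod q = b' y mod q"
  shows "aff Z g e b = aff Z g' e' b'"
proof -
  have "(e y * i + b y) mod q = (e' y * i + b' y) mod q" if "y < N" for y i
    using assms(2,3)[OF that] by (intro mod_add_cong mod_mult_cong) auto
  then show ?thesis using assms(1) by (auto simp: aff_def fun_eq_iff)
qed

lemma aff_apply: "y < N \<Longrightarrow> i \<in> Z \<Longrightarrow> aff Z g e b (y, i) = (g y, (e y * i + b y) mod q)"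
  by (simp add: aff_def)

lemma V_permutes: "g \<in> V \<Longrightarrow> g permutes {..<N}"
  using subgroup.subset[OF V] by auto

lemma V_less [simp]: "g \<in> V \<Longrightarrow> g y < N \<longleftrightarrow> y < N"
  using permutes_in_image[OF V_permutes, of g y] by simp

lemma V_inv: "g \<in> V \<Longrightarrow> Hilbert_Choice.inv g \<in> V"
  using subgroup.m_inv_closed[OF V, of g] inv_perm_group[OF V_permutes, of g] by simp

lemma V_comp: "g \<in> V \<Longrightarrow> h \<in> V \<Longrightarrow> g \<circ> h \<in> V"
  using subgroup.m_closed[OF V, of g h] by simp

lemma V_id: "id \<in> V"
  using subgroup.one_closed[OF V] by simp

lemma V_inv_apply [simp]: "g \<in> V \<Longrightarrow> Hilbert_Choice.inv g (g y) = y"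
  "g \<in> V \<Longrightarrow> g (Hilbert_Choice.inv g y) = y"
  using permutes_inverses[OF V_permutes, of g] by auto

lemma mod_q_Zq [simp]: "i mod q \<in> Zq"
  using q_gt_1 by simp

lemma E_mult': "e mod q \<in> E \<Longrightarrow> u mod q \<in> E \<Longrightarrow> e * u mod q \<in> E"
  using E_mult[of "e mod q" "u mod q"] by (simp add: mod_simps)

lemma E_square': "e mod q \<in> E \<Longrightarrow> e * e mod q = 1"
  using E_square[of "e mod q"] by (simp add: mod_simps)

lemma E_mod: "e \<in> E \<Longrightarrow> e mod q = e"
  using E_sub by auto

lemma one_mod_E [simp]: "1 mod q \<in> E"
  using E_mod one_E by simp

text \<open>In the applications \<open>Z\<close> is either all of \<open>{0..<q}\<close>, or \<open>E\<close> with \<open>b = 0\<close>; the latter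
  gives the faithful action of the quotient by the translations.\<close>

lemma aff_comp:
  assumes "g' \<in> V" and "\<And>y i. y < N \<Longrightarrow> i \<in> Z \<Longrightarrow> (e' y * i + b' y) mod q \<in> Z"
  shows "aff Z g e b \<circ> aff Z g' e' b' =
    aff Z (g \<circ> g') (\<lambda>y. e (g' y) * e' y) (\<lambda>y. e (g' y) * b' y + b (g' y))"
proof
  fix x :: "nat \<times> int"
  obtain y i where x: "x = (y, i)" by (cases x)
  have "(e (g' y) * ((e' y * i + b' y) mod q) + b (g' y)) mod q
      = (e (g' y) * (e' y * i + b' y) + b (g' y)) mod q"
    by (rule mod_add_cong) (simp_all add: mod_mult_right_eq)
  also have "\<dots> = (e (g' y) * e' y * i + (e (g' y) * b' y + b (g' y))) mod q"
    by (simp add: algebra_simps)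
  finally show "(aff Z g e b \<circ> aff Z g' e' b') x =
      aff Z (g \<circ> g') (\<lambda>y. e (g' y) * e' y) (\<lambda>y. e (g' y) * b' y + b (g' y)) x"
    using assms by (auto simp: x aff_def)
qed

lemma aff_id: "Z \<subseteq> Zq \<Longrightarrow> aff Z id (\<lambda>_. 1) (\<lambda>_. 0) = id"
  by (auto simp: aff_def fun_eq_iff)

text \<open>Since \<open>e * e\<close> is 1 modulo \<open>q\<close>, the map sending
  \<open>i\<close> to \<open>e * i - e * b\<close> inverts the one sending \<open>i\<close> to
  \<open>e * i + b\<close>. Precomposing the coefficients with \<open>g'\<close> makes the target
  block of the given map the source block of its inverse.\<close>

lemma aff_inv:
  assumes "Z \<subseteq> Zq" and g: "g \<in> V" and e: "\<And>y. y < N \<Longrightarrow> e y mod q \<in> E"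
    and closed: "\<And>y i. y < N \<Longrightarrow> i \<in> Z \<Longrightarrow> (e y * i + b y) mod q \<in> Z"
  defines "g' \<equiv> Hilbert_Choice.inv g"
  shows "aff Z g' (\<lambda>y. e (g' y)) (\<lambda>y. - e (g' y) * b (g' y)) \<circ> aff Z g e b = id"
proof -
  have "aff Z g' (\<lambda>y. e (g' y)) (\<lambda>y. - e (g' y) * b (g' y)) \<circ> aff Z g e b =
      aff Z (g' \<circ> g) (\<lambda>y. e (g' (g y)) * e y)
        (\<lambda>y. e (g' (g y)) * b y + - e (g' (g y)) * b (g' (g y)))"
    by (rule aff_comp[OF g]) (rule closed)
  also have "\<dots> = aff Z id (\<lambda>_. 1) (\<lambda>_. 0)"
    using g q_gt_1 by (intro aff_cong) (auto simp: g'_def E_square' e)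
  finally show ?thesis using aff_id[OF assms(1)] by simp
qed

lemma aff_permutes:
  assumes Z: "Z \<subseteq> Zq" and g: "g \<in> V" and e: "\<And>y. y < N \<Longrightarrow> e y mod q \<in> E"
    and closed: "\<And>y i. y < N \<Longrightarrow> i \<in> Z \<Longrightarrow> (e y * i + b y) mod q \<in> Z"
  shows "aff Z g e b permutes {..<N} \<times> Z"
proof (rule bij_imp_permutes)
  let ?f = "aff Z g e b"
  have "inj ?f"
    by (rule inj_on_inverseI, rule fun_cong[OF aff_inv[OF assms], unfolded comp_apply id_apply])
  moreover have "?f ` ({..<N} \<times> Z) \<subseteq> {..<N} \<times> Z"
    using closed g by (auto simp: aff_apply)
  moreover have "finite ({..<N} \<times> Z)" using Z by (auto intro: finite_subset)
  ultimately show "bij_betw ?f ({..<N} \<times> Z) ({..<N} \<times> Z)"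
    by (metis bij_betw_def endo_inj_surj inj_on_subset top_greatest)
qed (auto simp: aff_def split: if_splits)

section \<open>The wreath product as a permutation group, and its order\<close>

lemma subgroup_W: "subgroup W (perm_group ({..<N} \<times> Zq))"
proof -
  interpret S: group "perm_group ({..<N} \<times> Zq)" by (rule group_perm_group)
  have perm: "aff Zq g e b permutes {..<N} \<times> Zq"
    if "g \<in> V" "\<forall>y<N. e y mod q \<in> E" for g e b
    using that by (intro aff_permutes) auto
  show ?thesis
  proof (rule S.subgroupI)
    show "W \<subseteq> carrier (perm_group ({..<N} \<times> Zq))" using perm by (auto simp: W_def)
    show "W \<noteq> {}" using W_I[OF V_id, of "\<lambda>_. 1"] by auto
  next
    fix f assume "f \<in> W"
    then obtain g e b where f: "f = aff Zq g e b" "g \<in> V" "\<forall>y<N. e y mod q \<in> E"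
      by (auto simp: W_def)
    define g' where "g' = Hilbert_Choice.inv g"
    have g': "g' \<in> V" using V_inv[OF f(2)] by (simp add: g'_def)
    let ?f' = "aff Zq g' (\<lambda>y. e (g' y)) (\<lambda>y. - e (g' y) * b (g' y))"
    have e': "\<forall>y<N. e (g' y) mod q \<in> E" using f g' by auto
    have "?f' \<circ> f = id"
      using aff_inv[of Zq g e b] f by (simp add: g'_def)
    then have "inv\<^bsub>perm_group ({..<N} \<times> Zq)\<^esub> f = ?f'"
      using perm[OF f(2,3)] perm[OF g' e'] by (intro S.inv_equality) (simp_all add: f(1))
    then show "inv\<^bsub>perm_group ({..<N} \<times> Zq)\<^esub> f \<in> W" using g' e' by (auto simp: W_def)
  next
    fix f f' assume "f \<in> W" "f' \<in> W"
    then obtain g e b g' e' b' where f: "f = aff Zq g e b" "g \<in> V" "\<forall>y<N. e y mod q \<in> E"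
      and f': "f' = aff Zq g' e' b'" "g' \<in> V" "\<forall>y<N. e' y mod q \<in> E"
      by (auto simp: W_def)
    have "f \<circ> f' = aff Zq (g \<circ> g') (\<lambda>y. e (g' y) * e' y) (\<lambda>y. e (g' y) * b' y + b (g' y))"
      unfolding f f' by (rule aff_comp) (use f' in auto)
    moreover have "g \<circ> g' \<in> V" using V_comp f f' by blast
    moreover have "\<forall>y<N. e (g' y) * e' y mod q \<in> E" using f f' by (auto intro!: E_mult')
    ultimately show "f \<otimes>\<^bsub>perm_group ({..<N} \<times> Zq)\<^esub> f' \<in> W" by (auto simp: W_def)
  qed
qed

lemma group_W: "group W_group"
  by (rule group.subgroup_imp_group[OF group_perm_group subgroup_W])

lemma W_permutes: "f \<in> W \<Longrightarrow> f permutes {..<N} \<times> Zq"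
  using subgroup.subset[OF subgroup_W] by auto

lemma W_comp: "f \<in> W \<Longrightarrow> h \<in> W \<Longrightarrow> f \<circ> h \<in> W"
  using subgroup.m_closed[OF subgroup_W, of f h] by simp

lemma finite_W: "finite W"
  using W_permutes by (intro finite_subset[OF _ finite_permutations[of "{..<N} \<times> Zq"]]) auto

text \<open>Evaluation at the residues 0 and 1, distinct because \<open>1 < q\<close>, recovers
  \<open>b y\<close> and \<open>e y + b y\<close>.\<close>

lemma affE:
  assumes "aff Zq g e b = aff Zq g' e' b'" "y < N"
  shows "g y = g' y" "e y mod q = e' y mod q" "b y mod q = b' y mod q"
proof -
  have "aff Zq g e b (y, i) = aff Zq g' e' b' (y, i)" for i using assms(1) by simp
  from this[of 0] this[of 1] show "g y = g' y" and b: "b y mod q = b' y mod q"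
    and eb: "e y mod q = e' y mod q"
  proof -
    assume "aff Zq g e b (y, 0) = aff Zq g' e' b' (y, 0)" "aff Zq g e b (y, 1) = aff Zq g' e' b' (y, 1)"
    then have *: "g y = g' y" "b y mod q = b' y mod q" "(e y + b y) mod q = (e' y + b' y) mod q"
      using assms(2) q_gt_1 by (auto simp: aff_apply)
    then show "g y = g' y" "b y mod q = b' y mod q" by auto
    have "(e y + b y - b y) mod q = (e' y + b' y - b' y) mod q"
      using *(3,2) by (rule mod_diff_cong)
    then show "e y mod q = e' y mod q" by simp
  qed
qed

text \<open>Coefficients reduced modulo \<open>q\<close> and extensional on \<open>{..<N}\<close>
  make the parametrisation by triples bijective.\<close>

lemma card_W: "card W = card V * card E ^ N * nat q ^ N"
proof -
  let ?D = "V \<times> ({..<N} \<rightarrow>\<^sub>E E) \<times> ({..<N} \<rightarrow>\<^sub>E Zq)"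
  have "bij_betw (\<lambda>(g, e, b). aff Zq g e b) ?D W"
  proof (rule bij_betw_imageI)
    show "inj_on (\<lambda>(g, e, b). aff Zq g e b) ?D"
    proof (rule inj_onI)
      fix x x' assume x: "x \<in> ?D" "x' \<in> ?D"
        and eq': "(\<lambda>(g, e, b). aff Zq g e b) x = (\<lambda>(g, e, b). aff Zq g e b) x'"
      obtain g e b g' e' b' where xx': "x = (g, e, b)" "x' = (g', e', b')" by (metis prod_cases3)
      then have V: "g \<in> V" "g' \<in> V"
        and E: "e \<in> {..<N} \<rightarrow>\<^sub>E E" "e' \<in> {..<N} \<rightarrow>\<^sub>E E"
        and Z: "b \<in> {..<N} \<rightarrow>\<^sub>E Zq" "b' \<in> {..<N} \<rightarrow>\<^sub>E Zq"
        and eq: "aff Zq g e b = aff Zq g' e' b'"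
        using x eq' by auto
      have "g y = g' y" for y
        using affE(1)[OF eq] permutes_not_in[OF V_permutes[OF V(1)]]
          permutes_not_in[OF V_permutes[OF V(2)]]
        by (cases "y < N") auto
      moreover have "e y = e' y" if "y < N" for y
        using affE(2)[OF eq that] E that E_mod by (auto simp: PiE_iff)
      moreover have "b y = b' y" if "y < N" for y
        using affE(3)[OF eq that] Z that by (auto simp: PiE_iff)
      ultimately show "x = x'"
        using PiE_ext[OF E] PiE_ext[OF Z] by (auto simp: xx' fun_eq_iff)
    qed
    show "(\<lambda>(g, e, b). aff Zq g e b) ` ?D = W"
    proof
      show "(\<lambda>(g, e, b). aff Zq g e b) ` ?D \<subseteq> W"
      proof clarsimp
        fix g e b assume "g \<in> V" and e: "e \<in> {..<N} \<rightarrow>\<^sub>E E"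
        have "e y mod q \<in> E" if "y < N" for y
          using PiE_mem[OF e, of y] that E_mod by simp
        then show "aff Zq g e b \<in> W" using \<open>g \<in> V\<close> by (intro W_I)
      qed
      show "W \<subseteq> (\<lambda>(g, e, b). aff Zq g e b) ` ?D"
      proof
        fix f assume "f \<in> W"
        then obtain g e b where f: "f = aff Zq g e b" "g \<in> V" "\<forall>y<N. e y mod q \<in> E"
          by (auto simp: W_def)
        have "f = aff Zq g (\<lambda>y\<in>{..<N}. e y mod q) (\<lambda>y\<in>{..<N}. b y mod q)"
          unfolding f(1) by (rule aff_cong) auto
        then show "f \<in> (\<lambda>(g, e, b). aff Zq g e b) ` ?D"
          using f(2,3) q_gt_1
          by (intro image_eqI[of _ _ "(g, \<lambda>y\<in>{..<N}. e y mod q, \<lambda>y\<in>{..<N}. b y mod q)"]) auto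
      qed
    qed
  qed
  then have "card W = card ?D" by (simp add: bij_betw_same_card)
  then show ?thesis by (simp add: card_cartesian_product card_PiE)
qed

section \<open>The subgroup of translations\<close>

lemma shift_W: "shift b \<in> W"
  using V_id by (auto simp: shift_def intro: W_I)

lemma shift_apply: "y < N \<Longrightarrow> i \<in> Zq \<Longrightarrow> shift b (y, i) = (y, (i + b y) mod q)"
  by (simp add: shift_def aff_apply)

lemma shift_comp: "shift b \<circ> shift c = shift (\<lambda>y. b y + c y)"
proof -
  have "shift b \<circ> shift c = aff Zq (id \<circ> id) (\<lambda>y. 1 * 1) (\<lambda>y. 1 * c y + b y)"
    unfolding shift_def using aff_comp[OF V_id, of Zq] by simp
  then show ?thesis by (simp add: shift_def add.commute)
qed

lemma shift_0: "shift (\<lambda>_. 0) = id"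
  by (simp add: shift_def aff_id)

text \<open>Both products keep \<open>g\<close> and \<open>e\<close>, so commuting with a
  translation becomes a congruence between translation parts via \<open>affE\<close>.\<close>

lemma aff_shift:
  assumes "g \<in> V"
  shows "aff Zq g e c \<circ> shift b = aff Zq g e (\<lambda>y. c y + e y * b y)"
    and "shift b \<circ> aff Zq g e c = aff Zq g e (\<lambda>y. c y + b (g y))"
  unfolding shift_def using assms V_id by (subst aff_comp; simp add: add.commute)+

lemma card_range_shift: "card (range shift) = nat q ^ N"
proof -
  have "bij_betw shift ({..<N} \<rightarrow>\<^sub>E Zq) (range shift)"
  proof (rule bij_betw_imageI)
    show "inj_on shift ({..<N} \<rightarrow>\<^sub>E Zq)"
    proof (rule inj_onI)
      fix b c assume Z: "b \<in> {..<N} \<rightarrow>\<^sub>E Zq" "c \<in> {..<N} \<rightarrow>\<^sub>E Zq" and eq: "shift b = shift c"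
      show "b = c"
      proof (rule PiE_ext[OF Z])
        fix y assume "y \<in> {..<N}"
        then show "b y = c y"
          using affE(3)[OF eq[unfolded shift_def], of y] Z by (auto simp: PiE_iff)
      qed
    qed
    have "shift b = shift (\<lambda>y\<in>{..<N}. b y mod q)" for b
      unfolding shift_def by (rule aff_cong) auto
    then show "shift ` ({..<N} \<rightarrow>\<^sub>E Zq) = range shift"
      using q_gt_1 by (auto simp: image_iff) (metis (no_types, lifting) PiE_restrict mod_q_Zq restrict_PiE_iff)
  qed
  then show ?thesis by (simp add: bij_betw_same_card[symmetric] card_PiE)
qed

section \<open>Linear parts and the quotient by the translations\<close>

text \<open>Differences within a block cancel the translation and leave \<open>e y * u\<close>.
  Reading them off the values of \<open>f\<close> makes the result independent of the chosen
  parameters.\<close>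

definition linear_part :: "(nat \<times> int \<Rightarrow> nat \<times> int) \<Rightarrow> nat \<times> int \<Rightarrow> nat \<times> int" where
  "linear_part f = (\<lambda>(y, u). if y < N \<and> u \<in> E
     then (fst (f (y, 0)), (snd (f (y, u)) - snd (f (y, 0))) mod q) else (y, u))"

lemma linear_part_aff: "linear_part (aff Zq g e b) = aff E g e (\<lambda>_. 0)"
proof
  fix x :: "nat \<times> int"
  obtain y u where x: "x = (y, u)" by (cases x)
  have "u \<in> Zq" if "u \<in> E" using E_sub that by blast
  then show "linear_part (aff Zq g e b) x = aff E g e (\<lambda>_. 0) x"
    using q_gt_1 by (auto simp: x linear_part_def aff_apply aff_def mod_simps)
qed

lemma E_closed: "e mod q \<in> E \<Longrightarrow> u \<in> E \<Longrightarrow> (e * u + 0) mod q \<in> E"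
  using E_mult'[of e u] E_mod by simp

lemma linear_part_hom: "group_hom W_group (perm_group ({..<N} \<times> E)) linear_part"
proof -
  have "linear_part \<in> hom W_group (perm_group ({..<N} \<times> E))"
  proof (rule homI)
    fix f assume "f \<in> carrier W_group"
    then obtain g e b where f: "f = aff Zq g e b" "g \<in> V" "\<forall>y<N. e y mod q \<in> E"
      by (auto simp: W_def)
    then have "aff E g e (\<lambda>_. 0) permutes {..<N} \<times> E"
      by (intro aff_permutes E_sub E_closed) auto
    then show "linear_part f \<in> carrier (perm_group ({..<N} \<times> E))" by (simp add: f(1) linear_part_aff)
  next
    fix f f' assume "f \<in> carrier W_group" "f' \<in> carrier W_group"
    then obtain g e b g' e' b' where f: "f = aff Zq g e b" "g \<in> V" "\<forall>y<N. e y mod q \<in> E"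
      and f': "f' = aff Zq g' e' b'" "g' \<in> V" "\<forall>y<N. e' y mod q \<in> E"
      by (auto simp: W_def)
    have "linear_part (f \<circ> f') = aff E (g \<circ> g') (\<lambda>y. e (g' y) * e' y) (\<lambda>y. 0)"
      unfolding f f' by (subst aff_comp) (use f' in \<open>auto simp: linear_part_aff\<close>)
    also have "\<dots> = aff E g e (\<lambda>_. 0) \<circ> aff E g' e' (\<lambda>_. 0)"
      by (subst aff_comp) (use f' E_closed in auto)
    finally show "linear_part (f \<otimes>\<^bsub>W_group\<^esub> f') = linear_part f \<otimes>\<^bsub>perm_group ({..<N} \<times> E)\<^esub> linear_part f'"
      by (simp add: f f' linear_part_aff)
  qed
  then show ?thesis
    by (intro group_hom.intro group_hom_axioms.intro group_W group_perm_group)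
qed

lemma kernel_linear_part: "kernel W_group (perm_group ({..<N} \<times> E)) linear_part = range shift"
proof
  show "kernel W_group (perm_group ({..<N} \<times> E)) linear_part \<subseteq> range shift"
  proof
    fix f assume "f \<in> kernel W_group (perm_group ({..<N} \<times> E)) linear_part"
    then have "f \<in> W" "linear_part f = id" by (auto simp: kernel_def)
    then obtain g e b where f: "f = aff Zq g e b" and id: "aff E g e (\<lambda>_. 0) = id"
      by (auto simp: W_def linear_part_aff)
    \<comment> \<open>The point \<open>(y, 1)\<close> is available because \<open>1 \<in> E\<close>,
      and its image reveals both \<open>g y\<close> and \<open>e y\<close>.\<close>
    have *: "g y = y \<and> e y mod q = 1" if "y < N" for y
      using fun_cong[OF id, of "(y, 1)"] that one_E by (simp add: aff_apply)
    have "f = shift b"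
      unfolding f shift_def by (rule aff_cong) (use * q_gt_1 in auto)
    then show "f \<in> range shift" by blast
  qed
  show "range shift \<subseteq> kernel W_group (perm_group ({..<N} \<times> E)) linear_part"
  proof
    fix f assume "f \<in> range shift"
    then obtain b where f: "f = shift b" by blast
    then have "linear_part f = id" by (simp add: shift_def linear_part_aff aff_id[OF E_sub])
    then show "f \<in> kernel W_group (perm_group ({..<N} \<times> E)) linear_part"
      using f shift_W by (simp add: kernel_def)
  qed
qed

lemma normal_shifts: "range shift \<lhd> W_group"
  using group_hom.normal_kernel[OF linear_part_hom] by (simp add: kernel_linear_part)

lemma card_linear_part_image: "card (linear_part ` W) = card V * card E ^ N"
proof -
  have "card (linear_part ` W) * nat q ^ N = card V * card E ^ N * nat q ^ N"
    using group_hom.card_image_mult_card_kernel[OF linear_part_hom]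
    by (simp add: kernel_linear_part card_range_shift card_W order_def)
  then show ?thesis using q_gt_1 by simp
qed

section \<open>Invariance of the translations under automorphisms\<close>

lemma aff_comp_id:
  "aff Zq id e b \<circ> aff Zq id e' b' = aff Zq id (\<lambda>y. e y * e' y) (\<lambda>y. e y * b' y + b y)"
  by (subst aff_comp) (use V_id in simp_all)

text \<open>Moving the translation across \<open>s\<close> gives a translation by
  \<open>e y * b y\<close> in the block \<open>g y\<close>; then \<open>s \<circ> u\<close>
  cancels.\<close>

lemma affine_conj_shift:
  assumes "s \<in> W" "u \<in> W" "s \<circ> u = id"
  shows "s \<circ> shift b \<circ> u \<in> range shift"
proof -
  obtain g e c where s: "s = aff Zq g e c" "g \<in> V" using assms(1) unfolding W_def by blast
  let ?g' = "Hilbert_Choice.inv g"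
  have "s \<circ> shift b = shift (\<lambda>y. e (?g' y) * b (?g' y)) \<circ> s"
    using s by (simp add: aff_shift)
  then have "s \<circ> shift b \<circ> u = shift (\<lambda>y. e (?g' y) * b (?g' y)) \<circ> (s \<circ> u)"
    by (simp only: comp_assoc)
  then show ?thesis using assms(3) by simp
qed

text \<open>An abelian normal subgroup \<open>A\<close> satisfies \<open>[t, a, a] = 1\<close> for every translation \<open>t\<close> and
  \<open>a \<in> A\<close>. If \<open>a\<close> moves the block \<open>y\<close> and \<open>t\<close> translates this block by \<open>1\<close>, then comparing both
  sides of \<open>a (t a t\<^sup>-\<^sup>1) = (t a t\<^sup>-\<^sup>1) a\<close> at \<open>a\<^sup>-\<^sup>1 (y, 0)\<close> gives \<open>a (y, 1) = a (y, - 1)\<close>.\<close>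

lemma fixes_blocks_if_commutes_with_conj:
  assumes f: "f \<in> W" and f_eq: "f = aff Zq g e c" and y: "y < N" and "2 < q"
    and comm: "\<And>b b'. shift b \<circ> shift b' = id \<Longrightarrow>
      f \<circ> (shift b \<circ> f \<circ> shift b') = (shift b \<circ> f \<circ> shift b') \<circ> f"
  shows "g y = y"
proof (rule ccontr)
  assume neq: "g y \<noteq> y"
  define b where "b = (\<lambda>z. if z = y then 1 else 0 :: int)"
  define t where "t = shift b"
  define t' where "t' = shift (\<lambda>z. - b z)"
  have tt': "t \<circ> t' = id" by (simp add: t_def t'_def shift_comp shift_0)
  have perm: "f permutes {..<N} \<times> Zq" using W_permutes[OF f] .
  obtain x i where x: "f (x, i) = (y, 0)" "x < N" "i \<in> Zq"
  proof -
    have "(y, 0) \<in> f ` ({..<N} \<times> Zq)" using permutes_image[OF perm] y q_gt_1 by simp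
    then show ?thesis using that by auto
  qed
  have "g x = y" using x by (simp add: f_eq aff_apply)
  then have "x \<noteq> y" using neq by auto
  have fix_b: "shift b' (z, j) = (z, j)" if "z < N" "j \<in> Zq" "b' z = 0" for b' z j
    using that by (simp add: shift_apply)
  have f_gy: "\<exists>j\<in>Zq. f (y, i) = (g y, j)" if "i \<in> Zq" for i
    using y that by (simp add: f_eq aff_apply)
  have gy: "g y < N" using permutes_in_image[OF perm, of "(y, 0)"] f_gy[of 0] y q_gt_1 by auto
  have "f (t (f (t' (x, i)))) = f (y, 1)"
    using x \<open>x \<noteq> y\<close> y q_gt_1 fix_b[of x i "\<lambda>z. - b z"]
    by (simp add: t_def t'_def b_def shift_apply)
  moreover have "t (f (t' (f (x, i)))) = f (y, (- 1) mod q)"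
  proof -
    have "t' (y, 0) = (y, (- 1) mod q)" using y q_gt_1 by (simp add: t'_def b_def shift_apply)
    moreover obtain j where "f (y, (- 1) mod q) = (g y, j)" "j \<in> Zq"
      using f_gy[OF mod_q_Zq] by blast
    ultimately show ?thesis using gy neq x by (simp add: t_def b_def fix_b)
  qed
  moreover have "f (t (f (t' (x, i)))) = t (f (t' (f (x, i))))"
    using fun_cong[OF comm[of b "\<lambda>z. - b z"], of "(x, i)"] tt' by (simp add: t_def t'_def)
  ultimately have "f (y, 1) = f (y, (- 1) mod q)" by simp
  from injD[OF permutes_inj[OF perm] this] have "1 = (- 1) mod q" by simp
  also have "\<dots> = q - 1" using q_gt_1 by (simp add: zmod_minus1)
  finally show False using \<open>2 < q\<close> by simp
qed

text \<open>The condition on \<open>q\<close> and \<open>N\<close> serves \<open>blocks\<close>: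
  with several blocks the residues 1 and -1 must differ, with a single block nothing can move. By
  \<open>form\<close> every image is then affine within each block, and it remains to show that the
  factors \<open>e y\<close> are 1.\<close>

lemma characteristic_shifts:
  assumes q: "2 < q \<or> N = 1" and E: "E = {1} \<or> q = 4 \<and> E = {1, 3}"
  shows "characteristic_subgroup (range shift) W_group"
proof -
  let ?B = "range shift"
  have sub: "subgroup ?B W_group" using normal_shifts by (rule normal_imp_subgroup)
  have fin: "finite ?B" using finite_W shift_W by (auto intro: finite_subset)
  have "\<alpha> ` ?B = ?B" if \<alpha>: "\<alpha> \<in> auto W_group" for \<alpha>
  proof -
    have \<alpha>_bij: "bij_betw \<alpha> W W" and \<alpha>_comp: "\<And>f h. f \<in> W \<Longrightarrow> h \<in> W \<Longrightarrow> \<alpha> (f \<circ> h) = \<alpha> f \<circ> \<alpha> h"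
      using \<alpha> by (auto simp: auto_def hom_def Bij_def)
    have \<alpha>_inj: "inj_on \<alpha> W" using \<alpha>_bij by (simp add: bij_betw_def)
    have \<alpha>_W: "\<alpha> f \<in> W" if "f \<in> W" for f using \<alpha>_bij that by (auto simp: bij_betw_def)
    have \<alpha>_surj: "\<exists>f'\<in>W. f = \<alpha> f'" if "f \<in> W" for f using \<alpha>_bij that by (auto simp: bij_betw_def)
    have \<alpha>_id: "\<alpha> id = id"
    proof -
      interpret group_hom W_group W_group \<alpha>
        using \<alpha> group_W by (auto simp: auto_def group_hom_def group_hom_axioms_def)
      show ?thesis using hom_one by simp
    qed
    have \<alpha>_comm: "\<alpha> f \<circ> \<alpha> h = \<alpha> h \<circ> \<alpha> f" if "f \<in> ?B" "h \<in> ?B" for f h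
    proof -
      have "f \<circ> h = h \<circ> f" using that by (auto simp: shift_comp add.commute)
      then show ?thesis using that \<alpha>_comp shift_W by (metis rangeE)
    qed
    have blocks: "g y = y" if f: "f \<in> ?B" "\<alpha> f = aff Zq g e c" "g \<in> V" and y: "y < N" for f g e c y
    proof (cases "N = 1")
      case True
      then show ?thesis using y f(3) V_less[of g y] by simp
    next
      case False
      have fW: "f \<in> W" using f shift_W by auto
      show ?thesis
      proof (rule fixes_blocks_if_commutes_with_conj[OF \<alpha>_W[OF fW] f(2) y])
        show "2 < q" using q False by simp
        fix b b' assume id: "shift b \<circ> shift b' = id"
        \<comment> \<open>The translations are pulled back through \<open>\<alpha>\<close>: the
          conjugate of \<open>\<alpha> f\<close> is the image of
          \<open>s \<circ> f \<circ> u\<close>, again a translation, so it commutes with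
          \<open>\<alpha> f\<close>.\<close>
        obtain s u where su: "s \<in> W" "\<alpha> s = shift b" "u \<in> W" "\<alpha> u = shift b'"
          using \<alpha>_surj shift_W by metis
        have "\<alpha> (s \<circ> u) = \<alpha> id" using su id \<alpha>_comp \<alpha>_id by simp
        then have "s \<circ> u = id"
          using \<alpha>_inj W_comp[OF su(1,3)] shift_W[of "\<lambda>_. 0"] by (auto simp: shift_0 dest: inj_onD)
        then have "s \<circ> f \<circ> u \<in> ?B" using f(1) su affine_conj_shift by blast
        moreover have "\<alpha> (s \<circ> f \<circ> u) = shift b \<circ> \<alpha> f \<circ> shift b'"
          using su fW by (simp add: \<alpha>_comp W_comp)
        ultimately show "\<alpha> f \<circ> (shift b \<circ> \<alpha> f \<circ> shift b') = (shift b \<circ> \<alpha> f \<circ> shift b') \<circ> \<alpha> f"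
          using \<alpha>_comm[OF f(1)] by metis
      qed
    qed
    have form: "\<exists>e c. \<alpha> f = aff Zq id e c \<and> (\<forall>y<N. e y \<in> E)" if "f \<in> ?B" for f
    proof -
      have "\<alpha> f \<in> W" using that shift_W \<alpha>_W by auto
      then obtain g e c where g: "\<alpha> f = aff Zq g e c" "g \<in> V" "\<forall>y<N. e y mod q \<in> E"
        by (auto simp: W_def)
      have "\<alpha> f = aff Zq id (\<lambda>y. e y mod q) c"
        unfolding g(1) by (rule aff_cong) (use blocks[OF that g(1,2)] in auto)
      then show ?thesis using g(3) by blast
    qed
    have "\<alpha> ` ?B \<subseteq> ?B"
    proof (cases "E = {1}")
      case True
      show ?thesis
      proof (rule image_subsetI)
        fix f assume "f \<in> ?B"
        then obtain e c where "\<alpha> f = aff Zq id e c" "\<forall>y<N. e y = 1" using form True by blast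
        moreover from this have "aff Zq id e c = shift c" unfolding shift_def by (intro aff_cong) auto
        ultimately show "\<alpha> f \<in> ?B" by simp
      qed
    next
      case False
      then have q4: "q = 4" and E13: "E = {1, 3}" using E by auto
      let ?B2 = "{f \<circ> f | f. f \<in> ?B}"
      have "\<alpha> ` ?B2 \<subseteq> ?B2"
      proof (rule image_subsetI)
        fix h assume "h \<in> ?B2"
        then obtain f where f: "f \<in> ?B" "h = f \<circ> f" by blast
        then obtain e c where ec: "\<alpha> f = aff Zq id e c" "\<forall>y<N. e y \<in> {1, 3}"
          using form E13 by blast
        \<comment> \<open>Where \<open>e y = 3\<close> the map is a reflection and its square is
          trivial, since \<open>3 * c + c\<close> vanishes modulo 4; hence the value 0.\<close>
        define c' where "c' = (\<lambda>y. if e y = 1 then c y else 0)"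
        have "\<alpha> h = \<alpha> f \<circ> \<alpha> f" using f shift_W \<alpha>_comp by auto
        also have "\<dots> = aff Zq id (\<lambda>y. e y * e y) (\<lambda>y. e y * c y + c y)"
          by (simp only: ec(1) aff_comp_id)
        also have "\<dots> = shift (\<lambda>y. c' y + c' y)"
          unfolding shift_def c'_def using ec(2) q4 by (intro aff_cong) auto
        finally have "\<alpha> h = shift c' \<circ> shift c'" by (simp add: shift_comp)
        then show "\<alpha> h \<in> ?B2" by blast
      qed
      moreover have "finite ?B2" using fin by (simp add: setcompr_eq_image)
      moreover have "?B2 \<subseteq> W" using shift_W W_comp by blast
      ultimately have "\<alpha> ` ?B2 = ?B2"
        using \<alpha>_inj by (intro endo_inj_surj) (auto intro: inj_on_subset)
      \<comment> \<open>Translation by 2 in every block is a square, hence the image of some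
        \<open>f0 \<circ> f0\<close>. The element \<open>\<alpha> f0\<close> will be the rotation of
        order 4 in every block.\<close>
      moreover have "shift (\<lambda>_. 1) \<circ> shift (\<lambda>_. 1) \<in> ?B2" by blast
      then have "shift (\<lambda>_. 2) \<in> ?B2" by (simp only: shift_comp) simp
      ultimately have "shift (\<lambda>_. 2) \<in> \<alpha> ` ?B2" by simp
      then obtain h where h: "shift (\<lambda>_. 2) = \<alpha> h" "h \<in> ?B2" by (rule imageE)
      from h(2) obtain f0 where "f0 \<in> ?B" "h = f0 \<circ> f0" by blast
      with h(1) have f0: "f0 \<in> ?B" "\<alpha> (f0 \<circ> f0) = shift (\<lambda>_. 2)" by simp_all
      from f0(1) obtain e0 c0 where ec0: "\<alpha> f0 = aff Zq id e0 c0" "\<forall>y<N. e0 y \<in> {1, 3}"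
        using form E13 by blast
      have "\<alpha> f0 \<circ> \<alpha> f0 = shift (\<lambda>_. 2)" using f0 shift_W \<alpha>_comp[of f0 f0] by auto
      moreover have "\<alpha> f0 \<circ> \<alpha> f0 = aff Zq id (\<lambda>y. e0 y * e0 y) (\<lambda>y. e0 y * c0 y + c0 y)"
        by (simp only: ec0(1) aff_comp_id)
      ultimately have "aff Zq id (\<lambda>y. e0 y * e0 y) (\<lambda>y. e0 y * c0 y + c0 y) = aff Zq id (\<lambda>_. 1) (\<lambda>_. 2)"
        by (simp add: shift_def)
      from affE(3)[OF this] have sq: "(e0 y * c0 y + c0 y) mod 4 = 2" if "y < N" for y
        using that q4 by simp
      \<comment> \<open>With \<open>e0 y = 3\<close> the square would translate by
        \<open>4 * c0 y\<close>, which is not 2 modulo 4.\<close>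
      have e0: "e0 y = 1 \<and> odd (c0 y)" if y: "y < N" for y
      proof -
        consider "e0 y = 1" | "e0 y = 3" using ec0(2) y by auto
        then show ?thesis
        proof cases
          case 1
          then have "(c0 y + c0 y) mod 4 = 2" using sq[OF y] by simp
          then have "odd (c0 y)" by presburger
          then show ?thesis using 1 by simp
        next
          case 2
          then have "(3 * c0 y + c0 y) mod 4 = 2" using sq[OF y] by simp
          then show ?thesis by presburger
        qed
      qed
      show ?thesis
      proof (rule image_subsetI)
        fix f assume f: "f \<in> ?B"
        then obtain e c where ec: "\<alpha> f = aff Zq id e c" "\<forall>y<N. e y \<in> {1, 3}"
          using form E13 by blast
        have "aff Zq id (\<lambda>y. e y * e0 y) (\<lambda>y. e y * c0 y + c y) =
            aff Zq id (\<lambda>y. e0 y * e y) (\<lambda>y. e0 y * c y + c0 y)"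
          using \<alpha>_comm[OF f f0(1)] by (simp only: ec(1) ec0(1) aff_comp_id)
        from affE(3)[OF this] have *: "(e y * c0 y + c y) mod 4 = (e0 y * c y + c0 y) mod 4"
          if "y < N" for y using that q4 by simp
        \<comment> \<open>If \<open>e y = 3\<close>, commuting with \<open>\<alpha> f0\<close>
          forces \<open>2 * c0 y\<close> to vanish modulo 4, but \<open>c0 y\<close> is odd.\<close>
        have "e y = 1" if "y < N" for y
        proof (rule ccontr)
          assume "e y \<noteq> 1"
          then have "e y = 3" using ec(2) that by auto
          then have "(3 * c0 y + c y) mod 4 = (c y + c0 y) mod 4" "odd (c0 y)"
            using *[OF that] e0[OF that] by auto
          then show False by presburger
        qed
        then have "\<alpha> f = shift c"
          unfolding ec(1) shift_def by (intro aff_cong) auto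
        then show "\<alpha> f \<in> ?B" by simp
      qed
    qed
    then show "\<alpha> ` ?B = ?B"
      using fin \<alpha>_inj shift_W by (intro endo_inj_surj) (auto intro: inj_on_subset)
  qed
  then show ?thesis using sub by (simp add: characteristic_subgroup_def)
qed

text \<open>\<open>s\<close> runs cyclically through the blocks, picking up the factor \<open>\<epsilon>\<close> once per turn.\<close>

lemma small_centralizer:
  assumes cyc: "cyc \<in> V" "\<And>y. y < N \<Longrightarrow> cyc y = Suc y mod N" and "\<epsilon> \<in> E"
  shows "\<exists>s\<in>W. card {f\<in>range shift. s \<circ> f = f \<circ> s} \<le> card {i\<in>Zq. \<epsilon> * i mod q = i}"
proof
  define e where "e = (\<lambda>y. if Suc y = N then \<epsilon> else 1)"
  define s where "s = aff Zq cyc e (\<lambda>_. 0)"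
  show "s \<in> W"
    unfolding s_def using cyc(1) \<open>\<epsilon> \<in> E\<close> E_mod by (intro W_I) (auto simp: e_def)
  have "{f\<in>range shift. s \<circ> f = f \<circ> s} \<subseteq> (\<lambda>i. shift (\<lambda>_. i)) ` {i\<in>Zq. \<epsilon> * i mod q = i}"
  proof clarify
    fix b assume "s \<circ> shift b = shift b \<circ> s"
    then have eq: "aff Zq cyc e (\<lambda>y. 0 + e y * b y) = aff Zq cyc e (\<lambda>y. 0 + b (cyc y))"
      unfolding s_def aff_shift[OF cyc(1)] .
    have *: "b (Suc y mod N) mod q = e y * b y mod q" if "y < N" for y
      using affE(3)[OF eq that] cyc(2)[OF that] by simp
    have const: "b y mod q = b 0 mod q" if "y < N" for y
      using that
    proof (induction y)
      case (Suc y)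
      then show ?case using *[of y] by (simp add: e_def)
    qed simp
    \<comment> \<open>All amounts agree modulo \<open>q\<close>; the return from block
      \<open>N - 1\<close> to block 0 makes the common value a fixed point of multiplication by
      \<open>\<epsilon>\<close>.\<close>
    have "b 0 mod q = \<epsilon> * b (N - 1) mod q"
      using *[of "N - 1"] N_pos by (simp add: e_def)
    also have "\<dots> = \<epsilon> * (b 0 mod q) mod q"
      using const[of "N - 1"] N_pos by (metis diff_less less_numeral_extra(1) mod_mult_right_eq)
    finally have "\<epsilon> * (b 0 mod q) mod q = b 0 mod q" ..
    moreover have "shift b = shift (\<lambda>_. b 0 mod q)"
      unfolding shift_def by (rule aff_cong, rule refl, rule refl, subst mod_mod_trivial, rule const)
    ultimately show "shift b \<in> (\<lambda>i. shift (\<lambda>_. i)) ` {i\<in>Zq. \<epsilon> * i mod q = i}"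
      using mod_q_Zq by blast
  qed
  then show "card {f\<in>range shift. s \<circ> f = f \<circ> s} \<le> card {i\<in>Zq. \<epsilon> * i mod q = i}"
    by (rule surj_card_le[rotated]) (auto intro: finite_subset[of _ Zq])
qed

end

section \<open>Sylow subgroups of symmetric groups of prime power degree\<close>

text \<open>The order of the cycle divides \<open>N = p ^ k\<close>, so it generates a
  \<open>p\<close>-group. This is conjugated into some Sylow subgroup \<open>S\<close>, and
  conjugating \<open>S\<close> back yields one that contains this very cycle.\<close>

lemma ex_sylow_containing_cycle:
  assumes "prime p" and N: "N = p ^ k"
  obtains V cyc where "sylow_subgroup p V (perm_group {..<N})" "cyc \<in> V"
    "\<And>y. y < N \<Longrightarrow> cyc y = Suc y mod N"
proof -
  let ?G = "perm_group {..<N}"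
  interpret G: group ?G by (rule group_perm_group)
  have fin: "finite (carrier ?G)" by (simp add: finite_permutations)
  have N_pos: "0 < N" using N prime_gt_0_nat[OF \<open>prime p\<close>] by simp
  define cyc where "cyc = (\<lambda>y. if y < N then Suc y mod N else y)"
  have "cyc permutes {..<N}"
  proof (rule bij_imp_permutes)
    show "bij_betw cyc {..<N} {..<N}"
    \<comment> \<open>Adding \<open>N - 1\<close> is subtraction of 1 modulo \<open>N\<close>, free
      of truncation at 0.\<close>
    proof (rule bij_betw_byWitness[where f' = "\<lambda>y. (y + (N - 1)) mod N"])
      show "\<forall>y\<in>{..<N}. (cyc y + (N - 1)) mod N = y"
      proof
        fix y assume y: "y \<in> {..<N}"
        then consider "Suc y < N" | "N = Suc y" by fastforce
        then show "(cyc y + (N - 1)) mod N = y"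
          using y by cases (simp_all add: cyc_def)
      qed
      show "\<forall>y\<in>{..<N}. cyc ((y + (N - 1)) mod N) = y"
        using N_pos by (auto simp: cyc_def mod_Suc_eq)
    qed (use N_pos in \<open>auto simp: cyc_def\<close>)
  qed (auto simp: cyc_def)
  then have cyc: "cyc \<in> carrier ?G" by simp
  have pow: "(cyc [^]\<^bsub>?G\<^esub> i) y = (y + i) mod N" if "y < N" for i :: nat and y
    using that
  proof (induction i arbitrary: y)
    case (Suc i)
    then show ?case using Suc.IH[of "Suc y mod N"] N_pos by (simp add: cyc_def mod_simps)
  qed simp
  have "cyc [^]\<^bsub>?G\<^esub> N = id"
  proof
    fix y
    show "(cyc [^]\<^bsub>?G\<^esub> N) y = id y"
      using pow[of y N] G.nat_pow_closed[OF cyc, of N] permutes_not_in[of "cyc [^]\<^bsub>?G\<^esub> N" "{..<N}" y]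
      by (cases "y < N") auto
  qed
  then have "group.ord ?G cyc dvd p ^ k" using G.pow_eq_id[OF cyc, of N] N by simp
  then obtain j where j: "group.ord ?G cyc = p ^ j"
    using \<open>prime p\<close> divides_primepow_nat by blast
  let ?Q = "generate ?G {cyc}"
  have Q: "subgroup ?Q ?G" using cyc by (intro G.generate_is_subgroup) simp
  have cQ: "card ?Q = p ^ j" using G.generate_pow_card[OF cyc] j by simp
  obtain m where m: "order ?G = p ^ multiplicity p (order ?G) * m"
    using multiplicity_dvd[of p "order ?G"] by (auto elim: dvdE)
  obtain S where S: "subgroup S ?G" "card S = p ^ multiplicity p (order ?G)"
    using sylow_thm[OF \<open>prime p\<close> G.is_group m fin] by blast
  then have "sylow_subgroup p S ?G" using fin by (simp add: sylow_subgroup_def)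
  from p_subgroup_conj_into_sylow[OF G.is_group \<open>prime p\<close> this Q cQ]
  obtain x where x: "x \<in> carrier ?G"
    and conj: "\<And>g. g \<in> ?Q \<Longrightarrow> x \<otimes>\<^bsub>?G\<^esub> g \<otimes>\<^bsub>?G\<^esub> inv\<^bsub>?G\<^esub> x \<in> S" by blast
  let ?f = "\<lambda>v. inv\<^bsub>?G\<^esub> x \<otimes>\<^bsub>?G\<^esub> v \<otimes>\<^bsub>?G\<^esub> x"
  have "inv\<^bsub>?G\<^esub> x <#\<^bsub>?G\<^esub> S #>\<^bsub>?G\<^esub> x = ?f ` S"
    by (auto simp del: perm_group_simps simp: l_coset_def r_coset_def)
  then have "subgroup (?f ` S) ?G"
    using G.subgroup_conjugation_is_surj1[OF x S(1)] by simp
  moreover have "card (?f ` S) = card S"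
  proof (rule card_image, rule inj_onI)
    fix v w assume "v \<in> S" "w \<in> S" "?f v = ?f w"
    then show "v = w"
      using G.conjugation_is_inj[of "inv\<^bsub>?G\<^esub> x" v w] G.inv_closed[OF x] G.inv_inv[OF x]
        subgroup.mem_carrier[OF S(1)] by metis
  qed
  ultimately have "sylow_subgroup p (?f ` S) ?G"
    using S(2) fin by (simp del: perm_group_simps add: sylow_subgroup_def)
  moreover have "cyc \<in> ?f ` S"
  proof (rule image_eqI)
    show "x \<otimes>\<^bsub>?G\<^esub> cyc \<otimes>\<^bsub>?G\<^esub> inv\<^bsub>?G\<^esub> x \<in> S" by (rule conj) (rule generate.incl, simp)
    have "inv\<^bsub>?G\<^esub> x \<in> carrier ?G" using x by (rule G.inv_closed)
    then show "cyc = ?f (x \<otimes>\<^bsub>?G\<^esub> cyc \<otimes>\<^bsub>?G\<^esub> inv\<^bsub>?G\<^esub> x)"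
      using x cyc by (simp del: perm_group_simps add: G.m_assoc) (simp del: perm_group_simps add: G.m_assoc[symmetric])
  qed
  ultimately show thesis using that by (simp add: cyc_def)
qed

lemma is_P_group:
  assumes "is_P p m G" and "prime p"
  shows "finite_p_group p G"
proof -
  obtain S where S: "sylow_subgroup p S (sym_group (p ^ m))" "G = (sym_group (p ^ m))\<lparr>carrier := S\<rparr>"
    using assms(1) by (auto simp: is_P_def)
  then have sub: "subgroup S (sym_group (p ^ m))" "finite (carrier (sym_group (p ^ m)))"
    and "card S = p ^ multiplicity p (order (sym_group (p ^ m)))"
    by (auto simp: sylow_subgroup_def)
  then show ?thesis
    using S(2) \<open>prime p\<close> group.subgroup_imp_group[OF sym_group_is_group sub(1)]
      finite_subset[OF subgroup.subset[OF sub(1)] sub(2)]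
    by (auto simp: finite_p_group_def order_def)
qed

section \<open>Transfer from the wreath product to \<open>Pn\<close>\<close>

text \<open>This is the common core of both parameter choices: \<open>Nq\<close> and
  \<open>card_Pn\<close> make \<open>W\<close> a Sylow subgroup on \<open>p ^ n\<close> points,
  \<open>NE\<close> and \<open>card_Pm\<close> do the same for the linear parts on
  \<open>p ^ m\<close> points, and \<open>\<epsilon>\<close> bounds the centralizer.\<close>

lemma (in affine_wreath) exists_uniserial_subgroup:
  assumes "prime p" and "is_P p n Pn" and "is_P p m Pm"
    and q: "2 < q \<or> N = 1" and E: "E = {1} \<or> q = 4 \<and> E = {1, 3}"
    and cyc: "cyc \<in> V" "\<And>y. y < N \<Longrightarrow> cyc y = Suc y mod N"
    and \<epsilon>: "\<epsilon> \<in> E" "card {i\<in>Zq. \<epsilon> * i mod q = i} \<le> p"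
    and Nq: "N * nat q = p ^ n" and NE: "N * card E = p ^ m"
    and card_Pn: "card V * card E ^ N * nat q ^ N = p ^ multiplicity p (fact (p ^ n) :: nat)"
    and card_Pm: "card V * card E ^ N = p ^ multiplicity p (fact (p ^ m) :: nat)"
  shows "\<exists>B. characteristic_subgroup B Pn \<and> comm_group (Pn\<lparr>carrier := B\<rparr>) \<and>
           Pn Mod B \<cong> Pm \<and>
           (\<forall>\<psi>\<in>iso Pm (Pn Mod B).
              uniserial_action p Pm (Pn\<lparr>carrier := B\<rparr>) (\<lambda>g. coset_conj Pn B (\<psi> g)))"
proof -
  have Pn: "finite_p_group p Pn" and Pm: "finite_p_group p Pm"
    using is_P_group assms(1-3) by auto
  interpret Pn: group Pn using Pn by (simp add: finite_p_group_def)
  have "group Pm" using Pm by (simp add: finite_p_group_def)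
  have finE: "finite E" using E_sub by (rule finite_subset) simp
  have "W_group \<cong> Pn"
  proof (rule iso_is_P[OF subgroup_W])
    show "card ({..<N} \<times> Zq) = p ^ n" using Nq by (simp add: card_cartesian_product)
    show "card W = p ^ multiplicity p (fact (p ^ n) :: nat)" using card_W card_Pn by simp
  qed (use assms in auto)
  then obtain f where f: "f \<in> iso W_group Pn" by (auto simp: is_iso_def)
  interpret f: group_hom W_group Pn f
    using f group_W Pn.is_group by (auto simp: group_hom_def group_hom_axioms_def iso_def)
  have f_inj: "inj_on f W" and f_surj: "f ` W = carrier Pn"
    using f by (auto simp: iso_iff)
  have f_comp: "f (x \<circ> y) = f x \<otimes>\<^bsub>Pn\<^esub> f y" if "x \<in> W" "y \<in> W" for x y
    using f.hom_mult[of x y] that by simp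
  define B where "B = f ` range shift"
  have char: "characteristic_subgroup B Pn"
    unfolding B_def
    by (rule characteristic_subgroup_iso_image[OF group_W Pn.is_group f characteristic_shifts[OF q E]])
  have normal: "B \<lhd> Pn" by (rule characteristic_subgroup_normal[OF Pn.is_group char])
  have comm: "comm_group (Pn\<lparr>carrier := B\<rparr>)"
  proof (rule group.group_comm_groupI)
    show "group (Pn\<lparr>carrier := B\<rparr>)"
      using Pn.subgroup_imp_group[OF normal_imp_subgroup[OF normal]] .
    fix x y assume "x \<in> carrier (Pn\<lparr>carrier := B\<rparr>)" "y \<in> carrier (Pn\<lparr>carrier := B\<rparr>)"
    then obtain b c where "x = f (shift b)" "y = f (shift c)" by (auto simp: B_def)
    then show "x \<otimes>\<^bsub>Pn\<lparr>carrier := B\<rparr>\<^esub> y = y \<otimes>\<^bsub>Pn\<lparr>carrier := B\<rparr>\<^esub> x"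
      by (simp add: f_comp[symmetric] shift_W shift_comp add.commute)
  qed
  interpret linear: group_hom W_group "perm_group ({..<N} \<times> E)" linear_part by (rule linear_part_hom)
  have "Pn Mod B \<cong> Pm"
  proof -
    define f' where "f' = inv_into W f"
    have f': "f' \<in> iso Pn W_group"
      using group.iso_set_sym[OF group_W f] by (simp add: f'_def)
    have f'f: "f' (f w) = w" if "w \<in> W" for w using f_inj that by (simp add: f'_def)
    have im: "f' ` carrier Pn = W" using f' by (simp add: iso_iff)
    \<comment> \<open>Composing with the inverse of \<open>f\<close> gives a homomorphism on
      \<open>Pn\<close> with kernel \<open>B\<close>, so that \<open>Pn Mod B\<close> is the group
      of linear parts.\<close>
    interpret h: group_hom Pn "perm_group ({..<N} \<times> E)" "linear_part \<circ> f'"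
      using f' linear.homh Pn.is_group group_perm_group
      by (auto simp: group_hom_def group_hom_axioms_def iso_def intro: Group.hom_compose)
    have "kernel Pn (perm_group ({..<N} \<times> E)) (linear_part \<circ> f') = f ` kernel W_group (perm_group ({..<N} \<times> E)) linear_part"
      by (force simp: kernel_def f_surj[symmetric] f'f)
    then have "kernel Pn (perm_group ({..<N} \<times> E)) (linear_part \<circ> f') = B"
      by (simp add: B_def kernel_linear_part)
    moreover have "(linear_part \<circ> f') ` carrier Pn = linear_part ` W" by (simp only: image_comp[symmetric] im)
    ultimately have "Pn Mod B \<cong> (perm_group ({..<N} \<times> E))\<lparr>carrier := linear_part ` W\<rparr>"
      using h.FactGroup_image_iso by simp
    moreover have "(perm_group ({..<N} \<times> E))\<lparr>carrier := linear_part ` W\<rparr> \<cong> Pm"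
    proof (rule iso_is_P)
      show "subgroup (linear_part ` W) (perm_group ({..<N} \<times> E))" using linear.img_is_subgroup by simp
      show "card ({..<N} \<times> E) = p ^ m" using NE by (simp add: card_cartesian_product)
      show "card (linear_part ` W) = p ^ multiplicity p (fact (p ^ m) :: nat)"
        using card_linear_part_image card_Pm by simp
    qed (use assms finE in auto)
    ultimately show ?thesis by (rule iso_trans)
  qed
  moreover have "uniserial_action p Pm (Pn\<lparr>carrier := B\<rparr>) (\<lambda>g. coset_conj Pn B (\<psi> g))"
    if \<psi>: "\<psi> \<in> iso Pm (Pn Mod B)" for \<psi>
  proof -
    obtain s where s: "s \<in> W"
      and cs: "card {w\<in>range shift. s \<circ> w = w \<circ> s} \<le> card {i\<in>Zq. \<epsilon> * i mod q = i}"
      using small_centralizer[OF cyc \<epsilon>(1)] by blast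
    have fs: "f s \<in> carrier Pn" using f.hom_closed s by simp
    have "{b\<in>B. f s \<otimes>\<^bsub>Pn\<^esub> b \<otimes>\<^bsub>Pn\<^esub> inv\<^bsub>Pn\<^esub> f s = b} \<subseteq> f ` {w\<in>range shift. s \<circ> w = w \<circ> s}"
    proof
      fix b assume b: "b \<in> {b\<in>B. f s \<otimes>\<^bsub>Pn\<^esub> b \<otimes>\<^bsub>Pn\<^esub> inv\<^bsub>Pn\<^esub> f s = b}"
      then obtain w where w: "w \<in> range shift" "b = f w" by (auto simp: B_def)
      have wW: "w \<in> W" using w shift_W by auto
      have "b \<in> carrier Pn" using w wW f.hom_closed by simp
      then have "f s \<otimes>\<^bsub>Pn\<^esub> b \<otimes>\<^bsub>Pn\<^esub> inv\<^bsub>Pn\<^esub> f s \<otimes>\<^bsub>Pn\<^esub> f s = f s \<otimes>\<^bsub>Pn\<^esub> b"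
        using fs by (simp add: Pn.m_assoc)
      moreover have "f s \<otimes>\<^bsub>Pn\<^esub> b \<otimes>\<^bsub>Pn\<^esub> inv\<^bsub>Pn\<^esub> f s = b" using b by blast
      ultimately have "f s \<otimes>\<^bsub>Pn\<^esub> b = b \<otimes>\<^bsub>Pn\<^esub> f s" by simp
      then have "f (s \<circ> w) = f (w \<circ> s)" using w wW s by (simp add: f_comp)
      then have "s \<circ> w = w \<circ> s" using f_inj W_comp s wW by (meson inj_onD)
      then show "b \<in> f ` {w\<in>range shift. s \<circ> w = w \<circ> s}" using w by blast
    qed
    moreover have "finite {w\<in>range shift. s \<circ> w = w \<circ> s}"
      using finite_W shift_W by (auto intro: finite_subset)
    ultimately have "card {b\<in>B. f s \<otimes>\<^bsub>Pn\<^esub> b \<otimes>\<^bsub>Pn\<^esub> inv\<^bsub>Pn\<^esub> f s = b} \<le> p"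
      using surj_card_le cs \<epsilon>(2) by (meson le_trans)
    then show ?thesis
      by (rule uniserial_coset_conj[OF Pn normal comm fs _ \<open>group Pm\<close> \<psi>])
  qed
  ultimately show ?thesis using char comm by blast
qed

theorem proposition1p8:
  fixes p n :: nat and Pn Pn1 :: "(nat \<Rightarrow> nat) monoid"
  assumes "prime p" and "n \<ge> 1"
    and "is_P p n Pn" and "is_P p (n - 1) Pn1"
  shows "\<exists>B. characteristic_subgroup B Pn \<and> comm_group (Pn\<lparr>carrier := B\<rparr>) \<and>
           Pn Mod B \<cong> Pn1 \<and>
           (\<forall>\<psi>\<in>iso Pn1 (Pn Mod B).
              uniserial_action p Pn1 (Pn\<lparr>carrier := B\<rparr>) (\<lambda>g. coset_conj Pn B (\<psi> g)))"
proof (cases "p = 2 \<and> n \<ge> 2")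
  case False
  define N where "N = p ^ (n - 1)"
  have pN: "p * N = p ^ n" using \<open>n \<ge> 1\<close> by (simp add: N_def power_eq_if)
  obtain V cyc where V: "sylow_subgroup p V (perm_group {..<N})" and cyc: "cyc \<in> V"
    "\<And>y. y < N \<Longrightarrow> cyc y = Suc y mod N"
    using ex_sylow_containing_cycle[OF \<open>prime p\<close> N_def] by blast
  have cV: "card V = p ^ multiplicity p (fact N :: nat)"
    using V by (simp add: sylow_subgroup_def order_perm_group)
  have p2: "2 \<le> p" using \<open>prime p\<close> by (rule prime_ge_2_nat)
  interpret affine_wreath "int p" "{1}" N V
    using V p2 by (intro affine_wreath.intro) (auto simp: N_def sylow_subgroup_def)
  have mult: "multiplicity p (fact (p ^ n) :: nat) = N + multiplicity p (fact N :: nat)"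
    using multiplicity_fact_mult[OF \<open>prime p\<close>, of N] pN by simp
  show ?thesis
  proof (rule exists_uniserial_subgroup[where cyc = cyc and \<epsilon> = 1])
    \<comment> \<open>The value \<open>p = 2\<close> occurs here only with \<open>n = 1\<close>, and
      then there is a single block.\<close>
    show "2 < int p \<or> N = 1" using False p2 \<open>n \<ge> 1\<close> by (cases "n = 1") (auto simp: N_def)
    show "card {i \<in> {0..<int p}. 1 * i mod int p = i} \<le> p"
      by (rule order_trans[OF card_mono[of "{0..<int p}"]]) auto
    show "N * nat (int p) = p ^ n" using pN by (simp add: mult.commute)
    show "card V * card {1 :: int} ^ N * nat (int p) ^ N = p ^ multiplicity p (fact (p ^ n) :: nat)"
      by (simp add: cV mult power_add)
    show "card V * card {1 :: int} ^ N = p ^ multiplicity p (fact (p ^ (n - 1)) :: nat)"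
      by (simp add: cV N_def)
  qed (use assms cyc in \<open>auto simp: N_def\<close>)
next
  case True
  \<comment> \<open>Blocks have size 4 and there are 2 units, so the group acts on
    \<open>4 * N\<close> points and its quotient on \<open>2 * N\<close>.\<close>
  define N :: nat where "N = 2 ^ (n - 2)"
  have N2: "2 * N = 2 ^ (n - 1)" and N4: "4 * N = 2 ^ n"
  proof -
    obtain k where "n = k + 2" using True by (metis add.commute le_Suc_ex)
    then show "2 * N = 2 ^ (n - 1)" "4 * N = 2 ^ n" by (simp_all add: N_def)
  qed
  obtain V cyc where V: "sylow_subgroup 2 V (perm_group {..<N})" and cyc: "cyc \<in> V"
    "\<And>y. y < N \<Longrightarrow> cyc y = Suc y mod N"
    using ex_sylow_containing_cycle[OF two_is_prime_nat N_def] by blast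
  have cV: "card V = 2 ^ multiplicity 2 (fact N :: nat)"
    using V by (simp add: sylow_subgroup_def order_perm_group)
  interpret affine_wreath 4 "{1, 3}" N V
    using V by (intro affine_wreath.intro) (auto simp: N_def sylow_subgroup_def)
  have mult1: "multiplicity 2 (fact (2 ^ (n - 1)) :: nat) = N + multiplicity 2 (fact N :: nat)"
    using multiplicity_fact_mult[OF two_is_prime_nat, of N] N2 by simp
  \<comment> \<open>Two steps of the recursion contribute \<open>2 * N\<close> and \<open>N\<close>,
    matching the factors \<open>4 ^ N\<close> and \<open>2 ^ N\<close> of the order of the wreath
    product.\<close>
  have mult: "multiplicity 2 (fact (2 ^ n) :: nat) = 3 * N + multiplicity 2 (fact N :: nat)"
  proof -
    have "2 * (2 * N) = 2 ^ n" using N4 by simp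
    then have "multiplicity 2 (fact (2 ^ n) :: nat) = 2 * N + multiplicity 2 (fact (2 * N) :: nat)"
      using multiplicity_fact_mult[OF two_is_prime_nat, of "2 * N"] by metis
    then show ?thesis using multiplicity_fact_mult[OF two_is_prime_nat, of N] by linarith
  qed
  show ?thesis
  proof (rule exists_uniserial_subgroup[where cyc = cyc and \<epsilon> = 3])
    \<comment> \<open>The unit 3 is -1 modulo 4 and fixes only 0 and 2; the unit 1 would fix all
      four residues, too many for \<open>p = 2\<close>.\<close>
    have "{i \<in> {0..<4 :: int}. 3 * i mod 4 = i} \<subseteq> {0, 2 :: int}"
    proof
      fix i :: int assume "i \<in> {i \<in> {0..<4}. 3 * i mod 4 = i}"
      then have "0 \<le> i" "i < 4" "3 * i mod 4 = i" by auto
      then have "i = 0 \<or> i = 2" by presburger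
      then show "i \<in> {0, 2}" by simp
    qed
    then have "card {i \<in> {0..<4 :: int}. 3 * i mod 4 = i} \<le> card {0, 2 :: int}" by (intro card_mono) auto
    then show "card {i \<in> {0..<4 :: int}. 3 * i mod 4 = i} \<le> p" using True by simp
    show "N * nat 4 = p ^ n" using N4 True by simp
    show "N * card {1, 3 :: int} = p ^ (n - 1)" using N2 True by simp
    have "(2 :: nat) ^ N * 4 ^ N = 2 ^ (3 * N)"
      by (simp add: power_mult_distrib[symmetric] power_mult)
    then show "card V * card {1, 3 :: int} ^ N * nat 4 ^ N = p ^ multiplicity p (fact (p ^ n) :: nat)"
      using True by (simp add: cV mult power_add numeral_2_eq_2[symmetric])
    show "card V * card {1, 3 :: int} ^ N = p ^ multiplicity p (fact (p ^ (n - 1)) :: nat)"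
      using True mult1 by (simp add: cV power_add numeral_2_eq_2[symmetric])
  qed (use assms cyc in auto)
qed

end
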